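(* Let $\mathcal V=\ker d_0^*\subset C^1(K)$ be the divergence-free edge-cochain space of a finite oriented two-dimensional cell complex $K$, let $P:C^1(K)\to\mathcal V$ be the orthogonal projector, $\Delta_1=d_0d_0^*+d_1^*d_1$, $\mathcal H^1=\ker\Delta_1\cap\mathcal V$, $\mathcal V_0=\mathcal V\cap(\mathcal H^1)^\perp$, $Q:\mathcal V\to\mathcal H^1$ the orthogonal projector and $P_0=I-Q$ on $\mathcal V$. Let $\widetilde B:\mathcal V\times\mathcal V\to\mathcal V$ be bilinear with $\langle\widetilde B(a,b),c\rangle=-\langle\widetilde B(a,c),b\rangle$ for all $a,b,c\in\mathcal V$, and set $B_0(a,b):=P_0\widetilde B(P_0a,P_0b)$. Let $\nu,\eta>0$ and let $f,g\in C^1(K)$ be time-independent with $QPf=QPg=0$. Consider on $\mathcal V\times\mathcal V$ the system $$\dot u=-\nu\Delta_1u+B_0(u,u)-B_0(h,h)+Pf,\qquad \dot h=-\eta\Delta_1h+B_0(u,h)-B_0(h,u)+Pg.$$ Then for every $(u_H,h_H)\in\mathcal H^1\times\mathcal H^1$: (i) the affine fibre $\mathcal X_{u_H,h_H}:=\{(u,h)\in\mathcal V\times\mathcal V:\ Qu=u_H,\ Qh=h_H\}$ is positively invariant; (ii) for every solution on this fibre, the complementary variables $u_0=P_0u$, $h_0=P_0h$ satisfy $$\frac12\frac{d}{dt}\bigl(\|u_0\|^2+\|h_0\|^2\bigr)+\nu\|\Delta_1^{1/2}u_0\|^2+\eta\|\Delta_1^{1/2}h_0\|^2=\langle P_0Pf,u_0\rangle+\langle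 P_0Pg,h_0\rangle,$$ where $P_0Pf=Pf\in\mathcal V_0$ and $P_0Pg=Pg\in\mathcal V_0$; (iii) the semiflow restricted to $\mathcal X_{u_H,h_H}$ has a compact global attractor; (iv) in the unforced case $f=g=0$, every solution on $\mathcal X_{u_H,h_H}$ satisfies, for $t\ge0$, $$\|P_0u(t)\|^2+\|P_0h(t)\|^2\leq\bigl(\|P_0u(0)\|^2+\|P_0h(0)\|^2\bigr)e^{-2\beta_+t},$$ where $\beta_+:=\min(\nu,\eta)\lambda_+$ and $\lambda_+$ is the smallest positive eigenvalue of $\Delta_1|_{\mathcal V}$ (assuming $\mathcal V_0\neq\{0\}$); thus every unforced trajectory on $\mathcal X_{u_H,h_H}$ converges to $(u_H,h_H)$ as $t\to\infty$.
   Context: $K$ is a finite oriented two-dimensional cell complex. The finite-dimensional real cochain spaces $C^q(K)$, $q=0,1,2$, carry fixed Euclidean inner products $\langle\cdot,\cdot\rangle$ with norms $\|\cdot\|$. The coboundary operators $d_0:C^0(K)\to C^1(K)$ and $d_1:C^1(K)\to C^2(K)$ are linear with $d_1d_0=0$; stars denote adjoints. The space $\mathcal V$ is invariant under $\Delta_1$, and $\mathcal H^1=\ker d_1\cap\ker d_0^*$. $\Delta_1^{1/2}$ is the nonnegative self-adjoint square root of $\Delta_1$. The system generates a continuous semiflow $S(t)$, $t\ge0$, on $\mathcal V\times\mathcal V$. A set is positively invariant if $S(t)$ maps it into itself for all $t\ge0$. A compact global attractor on a fibre $\mathcal X$ is a nonempty compact set $\mathcal A\subset\mathcal X$ with $S(t)\mathcal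 A=\mathcal A$ for all $t\ge0$ such that $\sup_{x\in D}\operatorname{dist}(S(t)x,\mathcal A)\to0$ as $t\to\infty$ for every bounded $D\subset\mathcal X$. *)

theory Defs
  imports "HOL-Analysis.Analysis"
begin

section \<open>Finite oriented two-dimensional cell complexes and their cochains\<close>

text \<open>
  A complex is given by its oriented cells, the two endpoints of every edge, and the integral
  incidence numbers between 2-cells and edges (the degrees of the attaching maps over the edges).
  The last conjunct below says that the boundary of every 2-cell is a 1-cycle.
\<close>

record ('v, 'e, 'f) cell_complex =
  verts :: "'v set"
  edges :: "'e set"
  faces :: "'f set"
  src :: "'e \<Rightarrow> 'v"
  tgt :: "'e \<Rightarrow> 'v"
  inc :: "'f \<Rightarrow> 'e \<Rightarrow> int"

definition finite_cell_complex2 :: "('v, 'e, 'f) cell_complex \<Rightarrow> bool" where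
  "finite_cell_complex2 K \<longleftrightarrow>
     finite (verts K) \<and> finite (edges K) \<and> finite (faces K) \<and>
     verts K \<noteq> {} \<and> faces K \<noteq> {} \<and>
     (\<forall>e\<in>edges K. src K e \<in> verts K \<and> tgt K e \<in> verts K) \<and>
     (\<forall>c\<in>faces K. \<forall>v\<in>verts K.
        (\<Sum>e\<in>edges K. inc K c e * (of_bool (v = tgt K e) - of_bool (v = src K e))) = 0)"

text \<open>
  The inner product on the space of \<open>q\<close>-cochains is arbitrary, so this space is an
  inner product space \<open>'c\<close> together with a map \<open>val\<close> evaluating cochains on cells, through
  which \<open>'c\<close> is linearly isomorphic to the space of real functions on the given set of cells.
  The class of real inner product spaces, unlike that of Euclidean spaces, admits dimension 0.
\<close>

definition cochain_space :: "'a set \<Rightarrow> ('c::real_inner \<Rightarrow> 'a \<Rightarrow> real) \<Rightarrow> bool" where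
  "cochain_space A val \<longleftrightarrow>
     (\<forall>a. linear (\<lambda>c. val c a)) \<and> bij_betw val UNIV {\<phi>. \<forall>a. a \<notin> A \<longrightarrow> \<phi> a = 0}"

definition is_coboundary0 ::
  "('v, 'e, 'f) cell_complex \<Rightarrow> ('c0 \<Rightarrow> 'v \<Rightarrow> real) \<Rightarrow> ('c1 \<Rightarrow> 'e \<Rightarrow> real) \<Rightarrow> ('c0 \<Rightarrow> 'c1) \<Rightarrow> bool" where
  "is_coboundary0 K val0 val1 d0 \<longleftrightarrow>
     (\<forall>p. \<forall>e\<in>edges K. val1 (d0 p) e = val0 p (tgt K e) - val0 p (src K e))"

definition is_coboundary1 ::
  "('v, 'e, 'f) cell_complex \<Rightarrow> ('c1 \<Rightarrow> 'e \<Rightarrow> real) \<Rightarrow> ('c2 \<Rightarrow> 'f \<Rightarrow> real) \<Rightarrow> ('c1 \<Rightarrow> 'c2) \<Rightarrow> bool" where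
  "is_coboundary1 K val1 val2 d1 \<longleftrightarrow>
     (\<forall>a. \<forall>c\<in>faces K. val2 (d1 a) c = (\<Sum>e\<in>edges K. of_int (inc K c e) * val1 a e))"

definition cochain_complex2 ::
  "('v, 'e, 'f) cell_complex \<Rightarrow>
   ('c0::real_inner \<Rightarrow> 'v \<Rightarrow> real) \<Rightarrow> ('c1::real_inner \<Rightarrow> 'e \<Rightarrow> real) \<Rightarrow> ('c2::real_inner \<Rightarrow> 'f \<Rightarrow> real) \<Rightarrow>
   ('c0 \<Rightarrow> 'c1) \<Rightarrow> ('c1 \<Rightarrow> 'c2) \<Rightarrow> bool" where
  "cochain_complex2 K val0 val1 val2 d0 d1 \<longleftrightarrow>
     finite_cell_complex2 K \<and>
     cochain_space (verts K) val0 \<and> cochain_space (edges K) val1 \<and> cochain_space (faces K) val2 \<and>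
     is_coboundary0 K val0 val1 d0 \<and> is_coboundary1 K val1 val2 d1"

lemma cochain_space_eqI:
  assumes "cochain_space A val" and "\<And>a. a \<in> A \<Longrightarrow> val c a = val c' a"
  shows "c = c'"
proof -
  have inj: "inj val" and ran: "\<And>x. val x \<in> {\<phi>. \<forall>a. a \<notin> A \<longrightarrow> \<phi> a = 0}"
    using assms(1) unfolding cochain_space_def bij_betw_def by auto
  have "val c = val c'"
  proof
    fix a show "val c a = val c' a"
      using assms(2) ran[of c] ran[of c'] by (cases "a \<in> A") auto
  qed
  then show ?thesis using inj by (simp add: inj_eq)
qed

lemma cochain_complex2_linear:
  assumes "cochain_complex2 K val0 val1 val2 d0 d1"
  shows "linear d0" and "linear d1"
proof -
  have C: "cochain_space (verts K) val0" "cochain_space (edges K) val1" "cochain_space (faces K) val2"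
    and D: "is_coboundary0 K val0 val1 d0" "is_coboundary1 K val1 val2 d1"
    using assms unfolding cochain_complex2_def by auto
  have L: "linear (\<lambda>c. val0 c v)" "linear (\<lambda>c. val1 c e)" "linear (\<lambda>c. val2 c k)" for v e k
    using C unfolding cochain_space_def by auto
  note lins = linear_add[OF L(1)] linear_add[OF L(2)] linear_add[OF L(3)]
    linear_scale[OF L(1)] linear_scale[OF L(2)] linear_scale[OF L(3)]
  have D0: "\<And>p e. e \<in> edges K \<Longrightarrow> val1 (d0 p) e = val0 p (tgt K e) - val0 p (src K e)"
    and D1: "\<And>a c. c \<in> faces K \<Longrightarrow> val2 (d1 a) c = (\<Sum>e\<in>edges K. of_int (inc K c e) * val1 a e)"
    using D unfolding is_coboundary0_def is_coboundary1_def by auto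
  show "linear d0"
    by (rule linearI; rule cochain_space_eqI[OF C(2)]) (simp_all add: D0 lins algebra_simps)
  show "linear d1"
    by (rule linearI; rule cochain_space_eqI[OF C(3)])
       (simp_all add: D1 lins algebra_simps sum.distrib sum_distrib_left)
qed

lemma cochain_complex2_d1_d0:
  assumes "cochain_complex2 K val0 val1 val2 d0 d1"
  shows "d1 (d0 p) = 0"
proof -
  have K: "finite_cell_complex2 K" and C: "cochain_space (faces K) val2"
    and D: "is_coboundary0 K val0 val1 d0" "is_coboundary1 K val1 val2 d1"
    using assms unfolding cochain_complex2_def by auto
  have z: "val2 0 c = 0" for c
    using C linear_0[of "\<lambda>x. val2 x c"] unfolding cochain_space_def by blast
  have fin: "finite (verts K)" and ends: "\<And>e. e \<in> edges K \<Longrightarrow> src K e \<in> verts K \<and> tgt K e \<in> verts K"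
    using K unfolding finite_cell_complex2_def by auto
  have "val2 (d1 (d0 p)) c = val2 0 c" if c: "c \<in> faces K" for c
  proof -
    have sel: "(\<Sum>v\<in>verts K. val0 p v * of_bool (v = w)) = val0 p w" if "w \<in> verts K" for w
      using that fin by (simp add: of_bool_def if_distrib sum.delta cong: if_cong)
    have "val2 (d1 (d0 p)) c =
        (\<Sum>e\<in>edges K. of_int (inc K c e) * (val0 p (tgt K e) - val0 p (src K e)))"
      using D c unfolding is_coboundary0_def is_coboundary1_def by simp
    also have "\<dots> = (\<Sum>e\<in>edges K. \<Sum>v\<in>verts K.
        val0 p v * of_int (inc K c e * (of_bool (v = tgt K e) - of_bool (v = src K e))))"
    proof (rule sum.cong[OF refl])
      fix e assume "e \<in> edges K"
      then have "val0 p (tgt K e) - val0 p (src K e) =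
          (\<Sum>v\<in>verts K. val0 p v * of_bool (v = tgt K e) - val0 p v * of_bool (v = src K e))"
        using ends sel by (simp add: sum_subtractf)
      then show "of_int (inc K c e) * (val0 p (tgt K e) - val0 p (src K e)) =
          (\<Sum>v\<in>verts K. val0 p v * of_int (inc K c e * (of_bool (v = tgt K e) - of_bool (v = src K e))))"
        by (simp add: sum_distrib_left algebra_simps)
    qed
    also have "\<dots> = (\<Sum>v\<in>verts K. val0 p v *
        of_int (\<Sum>e\<in>edges K. inc K c e * (of_bool (v = tgt K e) - of_bool (v = src K e))))"
      by (subst sum.swap) (simp add: sum_distrib_left)
    also have "\<dots> = 0"
      using K c unfolding finite_cell_complex2_def by (intro sum.neutral) (simp del: of_int_sum)
    finally show ?thesis using z by simp
  qed
  then show ?thesis by (rule cochain_space_eqI[OF C])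
qed


section \<open>Hodge-theoretic objects on 1-cochains\<close>

definition laplace1 :: "('c0::real_inner \<Rightarrow> 'c1::real_inner) \<Rightarrow> ('c1 \<Rightarrow> 'c2::real_inner) \<Rightarrow> 'c1 \<Rightarrow> 'c1" where
  "laplace1 d0 d1 a = d0 (adjoint d0 a) + adjoint d1 (d1 a)"

definition divfree :: "('c0::real_inner \<Rightarrow> 'c1::real_inner) \<Rightarrow> 'c1 set" where
  "divfree d0 = {a. adjoint d0 a = 0}"

definition harmonic1 :: "('c0::real_inner \<Rightarrow> 'c1::real_inner) \<Rightarrow> ('c1 \<Rightarrow> 'c2::real_inner) \<Rightarrow> 'c1 set" where
  "harmonic1 d0 d1 = {a. laplace1 d0 d1 a = 0} \<inter> divfree d0"

definition divfree_nonharm ::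
  "('c0::real_inner \<Rightarrow> 'c1::real_inner) \<Rightarrow> ('c1 \<Rightarrow> 'c2::real_inner) \<Rightarrow> 'c1 set" where
  "divfree_nonharm d0 d1 = divfree d0 \<inter> orthogonal_comp (harmonic1 d0 d1)"

definition orth_proj :: "'a::real_inner set \<Rightarrow> 'a \<Rightarrow> 'a" where
  "orth_proj W x = (THE y. y \<in> W \<and> (\<forall>w\<in>W. (x - y) \<bullet> w = 0))"

abbreviation projP :: "('c0::real_inner \<Rightarrow> 'c1::real_inner) \<Rightarrow> 'c1 \<Rightarrow> 'c1" where
  "projP d0 \<equiv> orth_proj (divfree d0)"

abbreviation projQ ::
  "('c0::real_inner \<Rightarrow> 'c1::real_inner) \<Rightarrow> ('c1 \<Rightarrow> 'c2::real_inner) \<Rightarrow> 'c1 \<Rightarrow> 'c1" where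
  "projQ d0 d1 \<equiv> orth_proj (harmonic1 d0 d1)"

definition projP0 ::
  "('c0::real_inner \<Rightarrow> 'c1::real_inner) \<Rightarrow> ('c1 \<Rightarrow> 'c2::real_inner) \<Rightarrow> 'c1 \<Rightarrow> 'c1" where
  "projP0 d0 d1 a = a - projQ d0 d1 a"

definition op_sqrt :: "('a::real_inner \<Rightarrow> 'a) \<Rightarrow> 'a \<Rightarrow> 'a" where
  "op_sqrt L = (THE R. linear R \<and> (\<forall>x y. R x \<bullet> y = x \<bullet> R y) \<and> (\<forall>x. 0 \<le> R x \<bullet> x) \<and> R \<circ> R = L)"

definition eigenvalue_on :: "'a::real_vector set \<Rightarrow> ('a \<Rightarrow> 'a) \<Rightarrow> real \<Rightarrow> bool" where
  "eigenvalue_on V L l \<longleftrightarrow> (\<exists>a\<in>V. a \<noteq> 0 \<and> L a = l *\<^sub>R a)"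

definition lambda_plus ::
  "('c0::real_inner \<Rightarrow> 'c1::real_inner) \<Rightarrow> ('c1 \<Rightarrow> 'c2::real_inner) \<Rightarrow> real" where
  "lambda_plus d0 d1 = (LEAST l. 0 < l \<and> eigenvalue_on (divfree d0) (laplace1 d0 d1) l)"


section \<open>The system\<close>

definition bilinear_on :: "'a::real_vector set \<Rightarrow> ('a \<Rightarrow> 'a \<Rightarrow> 'a) \<Rightarrow> bool" where
  "bilinear_on V B \<longleftrightarrow>
     (\<forall>a\<in>V. \<forall>b\<in>V. B a b \<in> V) \<and>
     (\<forall>a\<in>V. \<forall>b\<in>V. \<forall>c\<in>V. B (a + b) c = B a c + B b c \<and> B a (b + c) = B a b + B a c) \<and>
     (\<forall>r. \<forall>a\<in>V. \<forall>b\<in>V. B (r *\<^sub>R a) b = r *\<^sub>R B a b \<and> B a (r *\<^sub>R b) = r *\<^sub>R B a b)"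

definition B0 ::
  "('c0::real_inner \<Rightarrow> 'c1::real_inner) \<Rightarrow> ('c1 \<Rightarrow> 'c2::real_inner) \<Rightarrow> ('c1 \<Rightarrow> 'c1 \<Rightarrow> 'c1) \<Rightarrow> 'c1 \<Rightarrow> 'c1 \<Rightarrow> 'c1" where
  "B0 d0 d1 B a b = projP0 d0 d1 (B (projP0 d0 d1 a) (projP0 d0 d1 b))"

definition mhd_field ::
  "('c0::real_inner \<Rightarrow> 'c1::real_inner) \<Rightarrow> ('c1 \<Rightarrow> 'c2::real_inner) \<Rightarrow> ('c1 \<Rightarrow> 'c1 \<Rightarrow> 'c1) \<Rightarrow>
   real \<Rightarrow> real \<Rightarrow> 'c1 \<Rightarrow> 'c1 \<Rightarrow> 'c1 \<times> 'c1 \<Rightarrow> 'c1 \<times> 'c1" where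
  "mhd_field d0 d1 B \<nu> \<eta> f g = (\<lambda>(u, h).
     (- \<nu> *\<^sub>R laplace1 d0 d1 u + B0 d0 d1 B u u - B0 d0 d1 B h h + projP d0 f,
      - \<eta> *\<^sub>R laplace1 d0 d1 h + B0 d0 d1 B u h - B0 d0 d1 B h u + projP d0 g))"

definition solution_in :: "'x::real_normed_vector set \<Rightarrow> ('x \<Rightarrow> 'x) \<Rightarrow> (real \<Rightarrow> 'x) \<Rightarrow> bool" where
  "solution_in X F x \<longleftrightarrow>
     (\<forall>t\<ge>0. x t \<in> X \<and> (x has_vector_derivative F (x t)) (at t within {0..}))"

definition continuous_semiflow_on :: "'x::topological_space set \<Rightarrow> (real \<Rightarrow> 'x \<Rightarrow> 'x) \<Rightarrow> bool" where
  "continuous_semiflow_on X S \<longleftrightarrow>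
     (\<forall>t\<ge>0. S t ` X \<subseteq> X) \<and>
     (\<forall>x\<in>X. S 0 x = x) \<and>
     (\<forall>s\<ge>0. \<forall>t\<ge>0. \<forall>x\<in>X. S (s + t) x = S s (S t x)) \<and>
     continuous_on ({0..} \<times> X) (\<lambda>(t, x). S t x)"

definition generates_semiflow ::
  "'x::real_normed_vector set \<Rightarrow> ('x \<Rightarrow> 'x) \<Rightarrow> (real \<Rightarrow> 'x \<Rightarrow> 'x) \<Rightarrow> bool" where
  "generates_semiflow X F S \<longleftrightarrow>
     continuous_semiflow_on X S \<and> (\<forall>x\<in>X. solution_in X F (\<lambda>t. S t x))"

definition positively_invariant :: "(real \<Rightarrow> 'x \<Rightarrow> 'x) \<Rightarrow> 'x set \<Rightarrow> bool" where
  "positively_invariant S D \<longleftrightarrow> (\<forall>t\<ge>0. S t ` D \<subseteq> D)"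

text \<open>The supremum is taken in \<open>[0,\<infinity>]\<close>, so that it is meaningful for every set \<open>D\<close>.\<close>

definition compact_global_attractor ::
  "(real \<Rightarrow> 'x \<Rightarrow> 'x) \<Rightarrow> 'x::metric_space set \<Rightarrow> 'x set \<Rightarrow> bool" where
  "compact_global_attractor S X A \<longleftrightarrow>
     A \<noteq> {} \<and> compact A \<and> A \<subseteq> X \<and> (\<forall>t\<ge>0. S t ` A = A) \<and>
     (\<forall>D. D \<subseteq> X \<and> bounded D \<longrightarrow>
        ((\<lambda>t. SUP x\<in>D. ennreal (infdist (S t x) A)) \<longlongrightarrow> 0) at_top)"

definition fibre ::
  "('c0::real_inner \<Rightarrow> 'c1::real_inner) \<Rightarrow> ('c1 \<Rightarrow> 'c2::real_inner) \<Rightarrow> 'c1 \<Rightarrow> 'c1 \<Rightarrow> ('c1 \<times> 'c1) set" where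
  "fibre d0 d1 uH hH =
     {(u, h). u \<in> divfree d0 \<and> h \<in> divfree d0 \<and> projQ d0 d1 u = uH \<and> projQ d0 d1 h = hH}"

end

theory Submission
  imports Defs
begin

text \<open>
  The harmonic part of the state is a conserved parameter, and the rest is a dissipative system with
  an energy law. The Laplacian is self-adjoint and annihilates harmonic cochains, the projected
  nonlinearity has no harmonic component, and neither does the forcing; so the vector field maps
  \<open>V \<times> V\<close> into \<open>V0 \<times> V0\<close> (lemma \<open>field_V0\<close>), and every solution stays in its affine fibre
  \<open>(uH, hH) + V0 \<times> V0\<close> (lemma \<open>fibre_invariant\<close>).

  On the fibre the nonlinearity and the dissipation see only \<open>u - uH\<close> and \<open>h - hH\<close>. Skew symmetry
  removes the self-transport terms from the energy and makes the exchange terms between \<open>u\<close> and \<open>h\<close>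
  cancel (lemma \<open>field_energy\<close>), which gives the energy balance. The Laplacian quadratic form equals
  \<open>\<parallel>\<Delta>\<^sup>1\<^sup>/\<^sup>2 x\<parallel>\<^sup>2\<close> because the nonnegative square root exists and is unique (lemma \<open>op_sqrt_works\<close>), a
  consequence of the spectral theorem.

  Minimising the Rayleigh quotient of the Laplacian over the unit sphere of \<open>V0\<close> yields its least
  positive eigenvalue together with a spectral gap (lemma \<open>lambda_plus_gap\<close>). The gap turns the
  energy balance into a linear differential inequality. Without forcing this is the exponential
  decay. With forcing the energy relaxes to a bounded level, uniformly on bounded sets
  (lemma \<open>forced_energy_bound\<close>), so a closed ball of the fibre is a positively invariant absorbing
  set; it is compact because the fibre is finite dimensional. A continuous semiflow with such a set
  \<open>K\<close> has the attractor \<open>\<Inter>n. S n K\<close> (lemma \<open>attractor_of_compact_absorbing_set\<close>).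
\<close>

section \<open>Finite-dimensional subspaces of inner product spaces\<close>

text \<open>Containment in a finitely generated span, rather than equality with one, makes finite
  dimension pass to subsets without further argument. The cochain spaces are only known to be inner
  product spaces and may be zero, so the Euclidean type class does not apply to them.\<close>

definition finite_rank :: "'a::real_vector set \<Rightarrow> bool" where
  "finite_rank W \<longleftrightarrow> (\<exists>F. finite F \<and> W \<subseteq> span F)"

definition orthonormal_basis :: "'a::real_inner set \<Rightarrow> 'a set \<Rightarrow> bool" where
  "orthonormal_basis E W \<longleftrightarrow>
     finite E \<and> span E = W \<and> (\<forall>a\<in>E. \<forall>b\<in>E. a \<bullet> b = (if a = b then 1 else 0))"

lemma finite_rank_subset: "finite_rank W \<Longrightarrow> V \<subseteq> W \<Longrightarrow> finite_rank V"
  unfolding finite_rank_def by blast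

lemma orthonormal_basis_exists:
  fixes W :: "'a::real_inner set"
  assumes "subspace W" "finite_rank W"
  shows "\<exists>E. orthonormal_basis E W"
proof -
  obtain F where F: "finite F" "W \<subseteq> span F"
    using assms(2) unfolding finite_rank_def by blast
  obtain B where B: "B \<subseteq> W" "independent B" "W \<subseteq> span B"
    using maximal_independent_subset[of W] by blast
  have "finite B"
    using independent_span_bound[of F B] B F by blast
  then obtain C where C: "finite C" "span C = span B" "pairwise orthogonal C"
    using basis_orthogonal[of B] by blast
  have spanB: "span B = W"
    using B span_minimal[OF B(1) assms(1)] by blast
  define E where "E = (\<lambda>c. c /\<^sub>R norm c) ` (C - {0})"
  have "C \<subseteq> span E"
  proof
    fix c assume "c \<in> C"
    show "c \<in> span E"
    proof (cases "c = 0")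
      case False
      then have "c /\<^sub>R norm c \<in> span E"
        using \<open>c \<in> C\<close> unfolding E_def by (intro span_base) auto
      then have "norm c *\<^sub>R (c /\<^sub>R norm c) \<in> span E"
        by (rule span_scale)
      then show ?thesis using False by simp
    qed (simp add: span_zero)
  qed
  moreover have "E \<subseteq> span C"
    unfolding E_def by (auto intro!: span_scale intro: span_base)
  ultimately have "span E = span C"
    by (simp add: span_minimal subset_antisym)
  moreover have "a \<bullet> b = (if a = b then 1 else 0)" if "a \<in> E" "b \<in> E" for a b
  proof -
    obtain c d where cd: "c \<in> C" "d \<in> C" "c \<noteq> 0" "d \<noteq> 0" "a = c /\<^sub>R norm c" "b = d /\<^sub>R norm d"
      using \<open>a \<in> E\<close> \<open>b \<in> E\<close> unfolding E_def by auto
    have aa: "a \<bullet> a = 1"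
      using cd(3) unfolding cd(5) by (simp add: dot_square_norm power2_eq_square)
    show ?thesis
    proof (cases "c = d")
      case False
      then have "c \<bullet> d = 0"
        using C(3) cd unfolding pairwise_def orthogonal_def by blast
      then have "a \<bullet> b = 0" using cd by simp
      then show ?thesis using aa by auto
    next
      case True
      then have "a = b" using cd(5,6) by simp
      then show ?thesis using aa by simp
    qed
  qed
  ultimately show ?thesis
    using C(1,2) spanB unfolding orthonormal_basis_def by (intro exI[of _ E]) (simp add: E_def)
qed

lemma orthonormal_basis_expand:
  assumes "orthonormal_basis E W" "x \<in> W"
  shows "x = (\<Sum>e\<in>E. (x \<bullet> e) *\<^sub>R e)"
proof -
  have E: "finite E" "span E = W" "\<And>a b. a \<in> E \<Longrightarrow> b \<in> E \<Longrightarrow> a \<bullet> b = (if a = b then 1 else 0)"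
    using assms(1) unfolding orthonormal_basis_def by auto
  obtain c where c: "x = (\<Sum>e\<in>E. c e *\<^sub>R e)"
    using assms(2) E(2) span_finite[OF E(1)] by auto
  have "x \<bullet> b = c b" if "b \<in> E" for b
  proof -
    have "x \<bullet> b = (\<Sum>e\<in>E. c e * (e \<bullet> b))"
      unfolding c by (simp add: inner_sum_left)
    also have "\<dots> = (\<Sum>e\<in>E. if e = b then c b else 0)"
      using that E(3) by (intro sum.cong) auto
    also have "\<dots> = c b" using that E(1) by simp
    finally show ?thesis .
  qed
  then show ?thesis using c by simp
qed

lemma orthonormal_projection_residual:
  assumes "orthonormal_basis E W" "w \<in> W"
  shows "(x - (\<Sum>e\<in>E. (x \<bullet> e) *\<^sub>R e)) \<bullet> w = 0"
proof -
  have E: "finite E" "span E = W" "\<And>a b. a \<in> E \<Longrightarrow> b \<in> E \<Longrightarrow> a \<bullet> b = (if a = b then 1 else 0)"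
    using assms(1) unfolding orthonormal_basis_def by auto
  have b: "(x - (\<Sum>e\<in>E. (x \<bullet> e) *\<^sub>R e)) \<bullet> b = 0" if "b \<in> E" for b
  proof -
    have "(\<Sum>e\<in>E. (x \<bullet> e) *\<^sub>R e) \<bullet> b = (\<Sum>e\<in>E. if e = b then x \<bullet> b else 0)"
      unfolding inner_sum_left using that E(3) by (intro sum.cong) auto
    also have "\<dots> = x \<bullet> b" using that E(1) by simp
    finally show ?thesis by (simp add: inner_diff_left)
  qed
  have "(x - (\<Sum>e\<in>E. (x \<bullet> e) *\<^sub>R e)) \<bullet> (\<Sum>e\<in>E. (w \<bullet> e) *\<^sub>R e) = 0"
    unfolding inner_sum_right inner_scaleR_right by (simp add: b)
  then show ?thesis
    by (simp only: orthonormal_basis_expand[OF assms, symmetric])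
qed

lemma orth_proj_eqI:
  assumes "subspace W" "y \<in> W" "\<And>w. w \<in> W \<Longrightarrow> (x - y) \<bullet> w = 0"
  shows "orth_proj W x = y"
  unfolding orth_proj_def
proof (rule the_equality)
  fix z assume z: "z \<in> W \<and> (\<forall>w\<in>W. (x - z) \<bullet> w = 0)"
  have "z - y \<in> W" using z assms(1,2) by (simp add: subspace_diff)
  then have "(x - y) \<bullet> (z - y) - (x - z) \<bullet> (z - y) = 0"
    using z assms(3) by simp
  then have "(z - y) \<bullet> (z - y) = 0"
    by (simp add: inner_diff_left)
  then show "z = y" by simp
qed (use assms in auto)

lemma
  fixes W :: "'a::real_inner set"
  assumes "subspace W" "finite_rank W"
  shows orth_proj_mem: "orth_proj W x \<in> W"
    and orth_proj_residual: "w \<in> W \<Longrightarrow> (x - orth_proj W x) \<bullet> w = 0"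
proof -
  obtain E where E: "orthonormal_basis E W"
    using orthonormal_basis_exists[OF assms] by blast
  define y where "y = (\<Sum>e\<in>E. (x \<bullet> e) *\<^sub>R e)"
  have yW: "y \<in> W"
    unfolding y_def using E assms(1)
    by (auto simp: orthonormal_basis_def intro!: subspace_sum subspace_scale intro: span_base)
  have res: "(x - y) \<bullet> w = 0" if "w \<in> W" for w
    using orthonormal_projection_residual[OF E that] unfolding y_def .
  have eq: "orth_proj W x = y"
    by (rule orth_proj_eqI[OF assms(1) yW res])
  show "orth_proj W x \<in> W" unfolding eq by (rule yW)
  show "(x - orth_proj W x) \<bullet> w = 0" if "w \<in> W" unfolding eq by (rule res[OF that])
qed

lemma linear_continuous_on_finite_rank:
  fixes L :: "'a::real_inner \<Rightarrow> 'b::real_normed_vector"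
  assumes "linear L" "subspace W" "finite_rank W"
  shows "continuous_on W L"
proof -
  obtain E where E: "orthonormal_basis E W"
    using orthonormal_basis_exists[OF assms(2,3)] by blast
  have "L x = (\<Sum>e\<in>E. (x \<bullet> e) *\<^sub>R L e)" if "x \<in> W" for x
    by (subst orthonormal_basis_expand[OF E that])
       (simp add: linear_sum[OF assms(1)] linear_scale[OF assms(1)])
  moreover have "continuous_on W (\<lambda>x. \<Sum>e\<in>E. (x \<bullet> e) *\<^sub>R L e)"
    by (intro continuous_intros)
  ultimately show ?thesis
    by (simp cong: continuous_on_cong)
qed

text \<open>Heine--Borel for finite-dimensional subspaces: the ball of radius \<open>r\<close> is closed in the set
  of combinations of an orthonormal basis with coefficients in \<open>[-r, r]\<close>, and that set is a finite
  sum of compact segments.\<close>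

lemma compact_finite_rank_cball:
  fixes W :: "'a::real_inner set"
  assumes "subspace W" "finite_rank W"
  shows "compact (W \<inter> cball 0 r)"
proof -
  obtain E where E: "orthonormal_basis E W"
    using orthonormal_basis_exists[OF assms] by blast
  then have finE: "finite E" and spanE: "span E = W"
    and on: "\<And>a. a \<in> E \<Longrightarrow> a \<bullet> a = 1"
    unfolding orthonormal_basis_def by auto
  have comp: "compact ((\<lambda>c. \<Sum>e\<in>A. c e *\<^sub>R e) ` {c. \<forall>e\<in>A. \<bar>c e\<bar> \<le> r})"
    if "finite A" for A :: "'a set"
    using that
  proof (induction A rule: finite_induct)
    case empty
    then show ?case by (simp add: image_constant_conv)
  next
    case (insert a A)
    let ?C = "\<lambda>A. (\<lambda>c. \<Sum>e\<in>A. c e *\<^sub>R e) ` {c. \<forall>e\<in>A. \<bar>c e\<bar> \<le> r}"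
    let ?I = "(\<lambda>t. t *\<^sub>R a) ` {-r..r}"
    have "?C (insert a A) = {x + y | x y. x \<in> ?I \<and> y \<in> ?C A}"
    proof (intro equalityI subsetI)
      fix z assume "z \<in> ?C (insert a A)"
      then obtain c where "\<forall>e\<in>insert a A. \<bar>c e\<bar> \<le> r" "z = c a *\<^sub>R a + (\<Sum>e\<in>A. c e *\<^sub>R e)"
        using insert by auto
      then show "z \<in> {x + y | x y. x \<in> ?I \<and> y \<in> ?C A}"
        by (force simp: abs_le_iff)
    next
      fix z assume "z \<in> {x + y | x y. x \<in> ?I \<and> y \<in> ?C A}"
      then obtain x y where xy: "z = x + y" "x \<in> ?I" "y \<in> ?C A" by blast
      obtain t where t: "-r \<le> t" "t \<le> r" "x = t *\<^sub>R a" using xy(2) by auto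
      obtain c where c: "\<forall>e\<in>A. \<bar>c e\<bar> \<le> r" "y = (\<Sum>e\<in>A. c e *\<^sub>R e)" using xy(3) by blast
      have tc: "\<bar>t\<bar> \<le> r" "z = t *\<^sub>R a + (\<Sum>e\<in>A. c e *\<^sub>R e)"
        using t c(2) xy(1) by (auto simp: abs_le_iff)
      have "(\<Sum>e\<in>A. c e *\<^sub>R e) = (\<Sum>e\<in>A. (c(a := t)) e *\<^sub>R e)"
        using insert by (intro sum.cong) auto
      then have "z = (\<Sum>e\<in>insert a A. (c(a := t)) e *\<^sub>R e)"
        using insert tc by simp
      then show "z \<in> ?C (insert a A)"
        using tc c(1) by (intro image_eqI[of _ _ "c(a := t)"]) auto
    qed
    moreover have "compact ?I"
      by (intro compact_continuous_image continuous_intros) auto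
    ultimately show ?case
      using insert compact_sums[of ?I "?C A"] by simp
  qed
  let ?K = "(\<lambda>c. \<Sum>e\<in>E. c e *\<^sub>R e) ` {c. \<forall>e\<in>E. \<bar>c e\<bar> \<le> r}"
  have eq: "W \<inter> cball 0 r = ?K \<inter> cball 0 r"
  proof (intro equalityI subsetI)
    fix x assume x: "x \<in> W \<inter> cball 0 r"
    have "\<bar>x \<bullet> e\<bar> \<le> r" if "e \<in> E" for e
      using Cauchy_Schwarz_ineq2[of x e] on[OF that] x by (simp add: norm_eq_sqrt_inner)
    then show "x \<in> ?K \<inter> cball 0 r"
      using x by (intro IntI image_eqI[of _ _ "\<lambda>e. x \<bullet> e"] orthonormal_basis_expand[OF E]) auto
  next
    fix x assume "x \<in> ?K \<inter> cball 0 r"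
    then show "x \<in> W \<inter> cball 0 r"
      using spanE by (auto intro!: span_sum span_scale intro: span_base)
  qed
  show ?thesis
    unfolding eq by (rule compact_Int_closed[OF comp[OF finE] closed_cball])
qed

text \<open>The adjoint is a choice of a map with the defining property. A finite-dimensional domain is what
  makes such a map exist: the functional \<open>f _ \<bullet> y\<close> is represented by \<open>\<Sum>e. (f e \<bullet> y) e\<close> for an
  orthonormal basis.\<close>

lemma adjoint_finite_rank:
  fixes f :: "'a::real_inner \<Rightarrow> 'b::real_inner"
  assumes "linear f" "finite_rank (UNIV :: 'a set)"
  shows "f x \<bullet> y = x \<bullet> adjoint f y"
proof -
  obtain E where E: "orthonormal_basis E (UNIV :: 'a set)"
    using orthonormal_basis_exists[OF subspace_UNIV assms(2)] by blast
  define h where "h y = (\<Sum>e\<in>E. (f e \<bullet> y) *\<^sub>R e)" for y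
  have "f x \<bullet> y = x \<bullet> h y" for x y
    by (subst orthonormal_basis_expand[OF E, of x, simplified])
       (simp add: h_def linear_sum[OF assms(1)] linear_scale[OF assms(1)] inner_sum_left
          inner_sum_right mult.commute)
  then show ?thesis
    using adjoint_unique[of f h] by simp
qed

lemma adjoint_linear_finite_rank:
  fixes f :: "'a::real_inner \<Rightarrow> 'b::real_inner"
  assumes "linear f" "finite_rank (UNIV :: 'a set)"
  shows "linear (adjoint f)"
proof (rule linearI)
  note ad = adjoint_finite_rank[OF assms, symmetric]
  fix y z :: 'b and r :: real
  show "adjoint f (y + z) = adjoint f y + adjoint f z"
    by (rule vector_eq_rdot[THEN iffD1]) (simp add: ad inner_add_right inner_commute[of _ "_::'a"])
  show "adjoint f (r *\<^sub>R y) = r *\<^sub>R adjoint f y"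
    by (rule vector_eq_rdot[THEN iffD1]) (simp add: ad inner_commute[of _ "_::'a"])
qed

section \<open>Rayleigh quotients, eigenbases and the square root\<close>

text \<open>At a minimiser \<open>e\<close> of the Rayleigh quotient, with minimum \<open>m\<close>, the form
  \<open>(L x - m x) \<bullet> x\<close> is nonnegative on \<open>W\<close> and vanishes at \<open>e\<close>. Moving from \<open>e\<close> to \<open>e - t y\<close>, where
  \<open>y = L e - m e\<close> is the residual, changes it by \<open>- 2 t (y \<bullet> y)\<close> to first order, so \<open>y = 0\<close>.\<close>

lemma rayleigh_minimizer:
  fixes L :: "'a::real_inner \<Rightarrow> 'a"
  assumes "linear L" "subspace W" "finite_rank W" "W \<noteq> {0}"
    and inv: "\<And>x. x \<in> W \<Longrightarrow> L x \<in> W"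
    and sym: "\<And>x y. L x \<bullet> y = x \<bullet> L y"
  shows "\<exists>e\<in>W. \<exists>m. norm e = 1 \<and> L e = m *\<^sub>R e \<and> (\<forall>x\<in>W. m * (x \<bullet> x) \<le> L x \<bullet> x)"
proof -
  have sub: "0 \<in> W" "\<And>x y. x \<in> W \<Longrightarrow> y \<in> W \<Longrightarrow> x + y \<in> W" "\<And>r x. x \<in> W \<Longrightarrow> r *\<^sub>R x \<in> W"
    using assms(2) unfolding subspace_def by auto
  let ?S = "W \<inter> sphere 0 1"
  have eq: "?S = (W \<inter> cball 0 1) \<inter> sphere 0 1" by auto
  have "closed (sphere (0::'a) 1)"
    using closed_Collect_eq[of "norm :: 'a \<Rightarrow> real" "\<lambda>_. 1"]
    by (simp add: sphere_def dist_norm continuous_on_norm_id)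
  then have comp: "compact ?S"
    unfolding eq by (rule compact_Int_closed[OF compact_finite_rank_cball[OF assms(2,3)]])
  obtain w where w: "w \<in> W" "w \<noteq> 0" using assms(4) sub(1) by blast
  have "w /\<^sub>R norm w \<in> ?S" using w sub(3) by simp
  then have ne: "?S \<noteq> {}" by blast
  have "continuous_on ?S (\<lambda>x. L x \<bullet> x)"
    by (intro continuous_intros continuous_on_subset[OF linear_continuous_on_finite_rank[OF assms(1-3)]]) auto
  from continuous_attains_inf[OF comp ne this]
  obtain e where e: "e \<in> W" "norm e = 1" and min: "\<And>x. x \<in> W \<Longrightarrow> norm x = 1 \<Longrightarrow> L e \<bullet> e \<le> L x \<bullet> x"
    by auto
  define m where "m = L e \<bullet> e"
  have ray: "m * (x \<bullet> x) \<le> L x \<bullet> x" if "x \<in> W" for x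
  proof (cases "x = 0")
    case False
    have "m \<le> L (x /\<^sub>R norm x) \<bullet> (x /\<^sub>R norm x)"
      unfolding m_def using False that sub(3) by (intro min) auto
    also have "\<dots> = (L x \<bullet> x) / (x \<bullet> x)"
      by (simp add: linear_scale[OF assms(1)] dot_square_norm power2_eq_square divide_simps)
    finally show ?thesis using False by (simp add: pos_le_divide_eq)
  qed simp
  define y where "y = L e - m *\<^sub>R e"
  have yW: "y \<in> W" unfolding y_def using e inv assms(2) by (simp add: subspace_diff subspace_scale)
  define q where "q = L y \<bullet> y - m * (y \<bullet> y)"
  have q0: "q \<ge> 0" unfolding q_def using ray[OF yW] by simp
  have ee: "e \<bullet> e = 1" using e(2) by (simp add: dot_square_norm)
  have ye: "L e \<bullet> y - m * (e \<bullet> y) = y \<bullet> y"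
    unfolding y_def by (simp add: algebra_simps inner_diff_left)
  have quad: "0 \<le> t\<^sup>2 * q - 2 * t * (y \<bullet> y)" for t
  proof -
    have "0 \<le> L (e - t *\<^sub>R y) \<bullet> (e - t *\<^sub>R y) - m * ((e - t *\<^sub>R y) \<bullet> (e - t *\<^sub>R y))"
      using ray[of "e - t *\<^sub>R y"] e yW assms(2) by (simp add: subspace_diff subspace_scale)
    also have "\<dots> = (L e \<bullet> e - m * (e \<bullet> e)) - 2 * t * (L e \<bullet> y - m * (e \<bullet> y)) + t\<^sup>2 * q"
      using sym[of y e] unfolding q_def
      by (simp add: linear_diff[OF assms(1)] linear_scale[OF assms(1)] inner_diff_left inner_diff_right
          inner_commute power2_eq_square algebra_simps)
    finally show ?thesis using ye ee m_def by simp
  qed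
  have "y \<bullet> y = 0"
  proof (rule ccontr)
    assume "y \<bullet> y \<noteq> 0"
    then have n: "y \<bullet> y > 0" by (simp add: less_le)
    \<comment> \<open>small enough for the linear term of \<open>quad\<close> to beat the quadratic one\<close>
    define t where "t = (y \<bullet> y) / (q + 1)"
    have "t > 0" unfolding t_def using n q0 by simp
    have "t * q \<le> y \<bullet> y" unfolding t_def using n q0 by (simp add: field_simps)
    then have "t * q - 2 * (y \<bullet> y) < 0" using n by linarith
    then have "t * (t * q - 2 * (y \<bullet> y)) < 0" using \<open>t > 0\<close> by (simp add: mult_pos_neg)
    then show False using quad[of t] by (simp add: power2_eq_square algebra_simps)
  qed
  then have "L e = m *\<^sub>R e" unfolding y_def by simp
  then show ?thesis using e ray by blast
qed

text \<open>Take an orthonormal set of eigenvectors of maximal size. Its orthogonal complement is invariant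
  by self-adjointness, so if it were nonzero it would contain one more eigenvector.\<close>

lemma spectral_theorem_finite_rank:
  fixes L :: "'a::real_inner \<Rightarrow> 'a"
  assumes "linear L" "finite_rank (UNIV :: 'a set)"
    and sym: "\<And>x y. L x \<bullet> y = x \<bullet> L y"
  shows "\<exists>E l. orthonormal_basis E UNIV \<and> (\<forall>e\<in>E. L e = l e *\<^sub>R e)"
proof -
  obtain F where F: "finite F" "(UNIV :: 'a set) \<subseteq> span F"
    using assms(2) unfolding finite_rank_def by blast
  define ok where "ok E \<longleftrightarrow> orthonormal_basis E (span E) \<and> (\<forall>e\<in>E. \<exists>l. L e = l *\<^sub>R e)" for E
  have bound: "card E \<le> card F" if "ok E" for E
  proof -
    have "pairwise orthogonal E" "0 \<notin> E"
      using that unfolding ok_def orthonormal_basis_def pairwise_def orthogonal_def by force+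
    then have "independent E" by (rule pairwise_orthogonal_independent)
    then show ?thesis using independent_span_bound[of F E] F by auto
  qed
  have "ok {}" unfolding ok_def orthonormal_basis_def by simp
  then have "\<exists>E. ok E \<and> (\<forall>E'. ok E' \<longrightarrow> card E' \<le> card E)"
    by (rule ex_has_greatest_nat[where b = "Suc (card F)"]) (simp add: bound less_Suc_eq_le)
  then obtain E where E: "ok E" and max: "\<And>E'. ok E' \<Longrightarrow> card E' \<le> card E"
    by blast
  have onb: "orthonormal_basis E (span E)" using E unfolding ok_def by blast
  let ?W = "{x. \<forall>e\<in>E. x \<bullet> e = 0}"
  have W0: "?W = {0}"
  proof (rule ccontr)
    assume ne: "?W \<noteq> {0}"
    have subW: "subspace ?W"
      unfolding subspace_def by (auto simp: inner_add_left)
    have frW: "finite_rank ?W" using finite_rank_subset[OF assms(2)] by blast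
    have "L x \<in> ?W" if "x \<in> ?W" for x
    proof (intro CollectI ballI)
      fix e assume "e \<in> E"
      then obtain l where "L e = l *\<^sub>R e" using E unfolding ok_def by blast
      then show "L x \<bullet> e = 0" using that sym \<open>e \<in> E\<close> by simp
    qed
    from rayleigh_minimizer[OF assms(1) subW frW ne this sym]
    obtain e m where e: "e \<in> ?W" "norm e = 1" "L e = m *\<^sub>R e" by blast
    have "e \<notin> E" using e(1,2) by auto
    have "ok (insert e E)"
      unfolding ok_def orthonormal_basis_def
      using E e \<open>e \<notin> E\<close> unfolding ok_def orthonormal_basis_def
      by (auto simp: inner_commute dot_square_norm)
    from max[OF this] show False
      using \<open>e \<notin> E\<close> onb unfolding orthonormal_basis_def by simp
  qed
  have "x \<in> span E" for x
  proof -
    have "x - (\<Sum>e\<in>E. (x \<bullet> e) *\<^sub>R e) \<in> ?W"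
      using orthonormal_projection_residual[OF onb] by (simp add: span_base)
    then have "x - (\<Sum>e\<in>E. (x \<bullet> e) *\<^sub>R e) = 0" using W0 by blast
    moreover have "(\<Sum>e\<in>E. (x \<bullet> e) *\<^sub>R e) \<in> span E"
      by (intro span_sum span_scale span_base)
    ultimately show ?thesis by simp
  qed
  then have "span E = UNIV" by auto
  moreover obtain l where "\<forall>e\<in>E. L e = l e *\<^sub>R e"
    using E bchoice[of E "\<lambda>e l. L e = l *\<^sub>R e"] unfolding ok_def by blast
  ultimately show ?thesis using onb by auto
qed

lemma linear_eq_on_orthonormal_basis:
  assumes "orthonormal_basis E UNIV" "linear f" "linear g" "\<And>e. e \<in> E \<Longrightarrow> f e = g e"
  shows "f = g"
proof
  fix x
  have "span E = UNIV" using assms(1) unfolding orthonormal_basis_def by blast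
  then show "f x = g x" using linear_eq_on[OF assms(2,3), of x E] assms(4) by blast
qed

text \<open>A nonnegative square root is obtained by taking square roots of the eigenvalues in an eigenbasis.
  Uniqueness is checked on an eigenvector \<open>e\<close> of \<open>L\<close> with eigenvalue \<open>s\<^sup>2\<close>: the vector
  \<open>y = R e - s e\<close> satisfies \<open>R y = - s y\<close>, which for \<open>s > 0\<close> contradicts positivity of \<open>R\<close>
  unless \<open>y = 0\<close>; for \<open>s = 0\<close> self-adjointness gives \<open>\<parallel>R e\<parallel>\<^sup>2 = L e \<bullet> e = 0\<close>.\<close>

lemma op_sqrt_works:
  fixes L :: "'a::real_inner \<Rightarrow> 'a"
  assumes lin: "linear L" and fr: "finite_rank (UNIV :: 'a set)"
    and sym: "\<And>x y. L x \<bullet> y = x \<bullet> L y"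
    and psd: "\<And>x. 0 \<le> L x \<bullet> x"
  shows "linear (op_sqrt L) \<and> (\<forall>x y. op_sqrt L x \<bullet> y = x \<bullet> op_sqrt L y)
     \<and> (\<forall>x. 0 \<le> op_sqrt L x \<bullet> x) \<and> op_sqrt L \<circ> op_sqrt L = L"
proof -
  obtain E l where onb: "orthonormal_basis E (UNIV :: 'a set)" and l: "\<And>e. e \<in> E \<Longrightarrow> L e = l e *\<^sub>R e"
    using spectral_theorem_finite_rank[OF lin fr sym] by blast
  have E: "finite E" "\<And>a b. a \<in> E \<Longrightarrow> b \<in> E \<Longrightarrow> a \<bullet> b = (if a = b then 1 else 0)"
    using onb unfolding orthonormal_basis_def by auto
  have l0: "l e \<ge> 0" if "e \<in> E" for e
    using psd[of e] l[OF that] E(2)[OF that that] by simp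
  define s where "s e = sqrt (l e)" for e
  define R where "R x = (\<Sum>e\<in>E. (s e * (x \<bullet> e)) *\<^sub>R e)" for x
  have linR: "linear R"
    by (rule linearI)
       (simp_all add: R_def inner_add_left distrib_left scaleR_add_left sum.distrib scaleR_sum_right mult_ac)
  have Re: "R e = s e *\<^sub>R e" if "e \<in> E" for e
  proof -
    have "R e = (\<Sum>a\<in>E. if a = e then s e *\<^sub>R e else 0)"
      unfolding R_def using that E(2) by (intro sum.cong) auto
    then show ?thesis using that E(1) by simp
  qed
  have Rsym: "R x \<bullet> y = x \<bullet> R y" for x y
    unfolding R_def by (simp add: inner_sum_left inner_sum_right mult_ac inner_commute)
  have Rpsd: "0 \<le> R x \<bullet> x" for x
    unfolding R_def inner_sum_left
  proof (intro sum_nonneg)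
    fix e assume "e \<in> E"
    then have "0 \<le> s e * (x \<bullet> e)\<^sup>2" using l0 by (simp add: s_def)
    then show "0 \<le> (s e * (x \<bullet> e)) *\<^sub>R e \<bullet> x"
      by (simp add: power2_eq_square inner_commute mult_ac)
  qed
  have "R \<circ> R = L"
    by (rule linear_eq_on_orthonormal_basis[OF onb linear_compose[OF linR linR] lin])
       (simp add: Re linear_scale[OF linR] l, simp add: s_def l0)
  with linR Rsym Rpsd have ex:
    "linear R \<and> (\<forall>x y. R x \<bullet> y = x \<bullet> R y) \<and> (\<forall>x. 0 \<le> R x \<bullet> x) \<and> R \<circ> R = L"
    by blast
  have uniq: "R' = R"
    if R': "linear R' \<and> (\<forall>x y. R' x \<bullet> y = x \<bullet> R' y) \<and> (\<forall>x. 0 \<le> R' x \<bullet> x) \<and> R' \<circ> R' = L" for R'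
  proof (rule linear_eq_on_orthonormal_basis[OF onb _ linR])
    show linR': "linear R'" using R' by blast
    fix e assume e: "e \<in> E"
    have RR: "R' (R' e) = (s e * s e) *\<^sub>R e"
      using R' l[OF e] l0[OF e] by (metis comp_apply real_sqrt_mult_self s_def abs_of_nonneg)
    show "R' e = R e"
    proof (cases "s e = 0")
      case True
      then have "R' e \<bullet> R' e = 0" using R' RR by (metis inner_zero_right mult_zero_left scaleR_zero_left)
      then show ?thesis using True Re[OF e] by simp
    next
      case False
      then have pos: "s e > 0" using l0[OF e] by (simp add: s_def)
      define y where "y = R' e - s e *\<^sub>R e"
      have "R' y = - s e *\<^sub>R y"
        unfolding y_def by (simp add: linear_diff[OF linR'] linear_scale[OF linR'] RR algebra_simps)
      then have "0 \<le> - (s e * (y \<bullet> y))" using R' by (metis inner_scaleR_left mult_minus_left)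
      then have "s e * (y \<bullet> y) \<le> 0" by simp
      then have "y \<bullet> y \<le> 0" using pos by (simp add: mult_le_0_iff)
      then have "y = 0" using inner_ge_zero[of y] by (metis inner_eq_zero_iff order_antisym)
      then show ?thesis using Re[OF e] unfolding y_def by simp
    qed
  qed
  have eq: "op_sqrt L = R"
    unfolding op_sqrt_def by (rule the_equality) (fact ex, fact uniq)
  show ?thesis unfolding eq by (fact ex)
qed

section \<open>Attractors of semiflows with a compact absorbing set\<close>

lemma compact_nested_nonempty:
  fixes G :: "nat \<Rightarrow> 'a::t2_space set"
  assumes "\<And>n. compact (G n)" "\<And>n. G n \<noteq> {}" "\<And>m n. m \<le> n \<Longrightarrow> G n \<subseteq> G m"
  shows "(\<Inter>n. G n) \<noteq> {}"
proof -
  have "G 0 \<inter> (\<Inter>n\<in>UNIV. G n) \<noteq> {}"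
  proof (rule compact_imp_fip_image)
    fix I :: "nat set" assume I: "finite I"
    have "G (Max (insert 0 I)) \<subseteq> G 0 \<inter> (\<Inter>n\<in>I. G n)"
      using I by (intro Int_greatest INT_greatest assms(3)) auto
    then show "G 0 \<inter> (\<Inter>n\<in>I. G n) \<noteq> {}" using assms(2) by blast
  qed (auto intro: compact_imp_closed[OF assms(1)] assms(1))
  then show ?thesis by blast
qed

text \<open>The attractor is the nested intersection of the images \<open>S n K\<close>. Backward invariance and
  attraction are both instances of Cantor's intersection theorem: the first is applied to the
  preimages \<open>S n K \<inter> S(t)\<^sup>-\<^sup>1 {x}\<close>, the second to the points of \<open>S n K\<close> at distance at least
  \<open>\<epsilon>\<close> from the intersection.\<close>

lemma attractor_of_compact_absorbing_set:
  fixes S :: "real \<Rightarrow> 'x::metric_space \<Rightarrow> 'x"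
  assumes sf: "continuous_semiflow_on X S"
    and K: "compact K" "K \<subseteq> X" "K \<noteq> {}" "positively_invariant S K"
    and absorb: "\<And>D. D \<subseteq> X \<Longrightarrow> bounded D \<Longrightarrow> \<exists>T\<ge>0. \<forall>t\<ge>T. S t ` D \<subseteq> K"
  shows "compact_global_attractor S X (\<Inter>n. S (real n) ` K)"
proof -
  have inv: "\<And>t x. t \<ge> 0 \<Longrightarrow> x \<in> X \<Longrightarrow> S t x \<in> X"
    and add: "\<And>s t x. s \<ge> 0 \<Longrightarrow> t \<ge> 0 \<Longrightarrow> x \<in> X \<Longrightarrow> S (s + t) x = S s (S t x)"
    and cont2: "continuous_on ({0..} \<times> X) (\<lambda>(t, x). S t x)"
    using sf unfolding continuous_semiflow_on_def by auto
  have invK: "\<And>t x. t \<ge> 0 \<Longrightarrow> x \<in> K \<Longrightarrow> S t x \<in> K"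
    using K(4) unfolding positively_invariant_def by auto
  have cont: "continuous_on K (S t)" if "t \<ge> 0" for t
  proof -
    have "continuous_on K (\<lambda>x. (\<lambda>(t, x). S t x) (t, x))"
      using that K(2) by (intro continuous_on_compose2[OF cont2] continuous_intros) auto
    then show ?thesis by simp
  qed
  define F where "F n = S (real n) ` K" for n
  define A where "A = (\<Inter>n. F n)"
  have F_compact: "compact (F n)" for n
    unfolding F_def by (intro compact_continuous_image cont K) simp
  have F_ne: "F n \<noteq> {}" for n unfolding F_def using K(3) by simp
  have F_sub: "F n \<subseteq> K" for n unfolding F_def using invK by auto
  have F_step: "S t x \<in> F n" if x: "x \<in> F m" and t: "t \<ge> 0" "real n \<le> t + real m" for t x m n
  proof -
    obtain k where k: "k \<in> K" "x = S (real m) k" using x unfolding F_def by blast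
    have "S t x = S (t + real m) k" using add[of t "real m" k] k t(1) K(2) by auto
    also have "\<dots> = S (real n) (S (t + real m - real n) k)"
      using add[of "real n" "t + real m - real n" k] k(1) t(2) K(2) by auto
    finally show ?thesis unfolding F_def using invK[of "t + real m - real n" k] k(1) t(2) by auto
  qed
  have F_mono: "F n \<subseteq> F m" if "m \<le> n" for m n
  proof
    fix x assume "x \<in> F n"
    then obtain k where k: "k \<in> K" "x = S (real n) k" unfolding F_def by blast
    have "x = S (real m) (S (real n - real m) k)"
      using add[of "real m" "real n - real m" k] k that K(2) by auto
    then show "x \<in> F m" unfolding F_def using invK[of "real n - real m" k] k(1) that by auto
  qed
  have A_ne: "A \<noteq> {}"
    unfolding A_def by (rule compact_nested_nonempty[OF F_compact F_ne F_mono])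
  have A_compact: "compact A"
    unfolding A_def using F_compact compact_imp_closed
    by (metis (no_types) INF_lower UNIV_I closed_INT closed_Int_compact inf.absorb_iff1)
  have A_sub: "A \<subseteq> X" unfolding A_def using F_sub K(2) by blast
  have forward: "S t x \<in> A" if "t \<ge> 0" "x \<in> A" for t x
    unfolding A_def
  proof
    fix n
    have "x \<in> F n" using that(2) unfolding A_def by blast
    then show "S t x \<in> F n" using F_step[of x n t n] that(1) by simp
  qed
  have backward: "\<exists>y\<in>A. S t y = x" if t: "t \<ge> 0" and x: "x \<in> A" for t x
  proof -
    define G where "G n = F n \<inter> {y \<in> K. S t y = x}" for n
    have "{y \<in> K. S t y = x} = K \<inter> S t -` {x}" by blast
    then have "closed ({y \<in> K. S t y = x})"
      by (simp only: continuous_closed_preimage[OF cont[OF t] compact_imp_closed[OF K(1)] closed_singleton])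
    then have Gc: "compact (G n)" for n unfolding G_def using F_compact by (intro compact_Int_closed)
    have Gn: "G n \<noteq> {}" for n
    proof -
      obtain m :: nat where m: "t \<le> real m" using real_arch_simple by blast
      have "x \<in> F (n + m)" using x unfolding A_def by blast
        \<comment> \<open>split the time \<open>n + m\<close> as \<open>t + n + (m - t)\<close>, leaving the last \<open>t\<close> units to \<open>S t\<close>\<close>
      then obtain k where k: "k \<in> K" "x = S (real n + real m) k" unfolding F_def of_nat_add by blast
      define y where "y = S (real n) (S (real m - t) k)"
      have Kk: "S (real m - t) k \<in> K" using invK k(1) m by simp
      have "S t y = S (t + real n) (S (real m - t) k)"
        unfolding y_def using add[of t "real n"] t Kk K(2) by auto
      also have "\<dots> = S (t + real n + (real m - t)) k"
        using add[of "t + real n" "real m - t" k] t m k(1) K(2) by auto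
      also have "\<dots> = x" using k(2) by (simp add: algebra_simps)
      finally have "S t y = x" .
      moreover have "y \<in> F n" unfolding y_def F_def using Kk by blast
      ultimately show ?thesis unfolding G_def using F_sub by blast
    qed
    have "(\<Inter>n. G n) \<noteq> {}"
      by (rule compact_nested_nonempty[OF Gc Gn]) (use F_mono in \<open>auto simp: G_def\<close>)
    then show ?thesis unfolding G_def A_def by blast
  qed
  have close: "\<exists>n. \<forall>x\<in>F n. infdist x A < \<epsilon>" if "\<epsilon> > 0" for \<epsilon>
  proof (rule ccontr)
    assume neg: "\<not> ?thesis"
    define G where "G n = F n \<inter> {x. \<epsilon> \<le> infdist x A}" for n
    have cl: "closed {x. \<epsilon> \<le> infdist x A}"
      by (intro closed_Collect_le continuous_intros)
    have Gc: "compact (G n)" for n unfolding G_def using F_compact cl by (intro compact_Int_closed)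
    have Gn: "G n \<noteq> {}" for n using neg unfolding G_def by (auto simp: not_less)
    have "(\<Inter>n. G n) \<noteq> {}"
      by (rule compact_nested_nonempty[OF Gc Gn]) (use F_mono in \<open>auto simp: G_def\<close>)
    then obtain x where "x \<in> A" "\<epsilon> \<le> infdist x A" unfolding G_def A_def by blast
    then show False using that by simp
  qed
  have attract: "((\<lambda>t. SUP x\<in>D. ennreal (infdist (S t x) A)) \<longlongrightarrow> 0) at_top"
    if D: "D \<subseteq> X" "bounded D" for D
  proof (rule order_tendstoI)
    fix a :: ennreal assume "0 < a"
    then obtain b where b: "0 < b" "b < a" using dense by blast
    define \<epsilon> where "\<epsilon> = enn2real b"
    have bt: "b < top" using b(2) top_greatest[of a] by (rule order_less_le_trans)
    have eps: "\<epsilon> > 0" "ennreal \<epsilon> = b"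
      unfolding \<epsilon>_def using b(1) bt by (auto simp: enn2real_positive_iff ennreal_enn2real_if)
    obtain n where n: "\<And>x. x \<in> F n \<Longrightarrow> infdist x A < \<epsilon>" using close[OF eps(1)] by blast
    obtain T where T: "T \<ge> 0" "\<And>t. t \<ge> T \<Longrightarrow> S t ` D \<subseteq> K" using absorb[OF D] by blast
    show "eventually (\<lambda>t. (SUP x\<in>D. ennreal (infdist (S t x) A)) < a) at_top"
    proof (rule eventually_at_top_linorderI)
      fix t assume t: "t \<ge> T + real n"
      have "infdist (S t x) A < \<epsilon>" if x: "x \<in> D" for x
      proof -
        have "S t x = S (real n) (S (t - real n) x)"
          using add[of "real n" "t - real n" x] t T(1) x D(1) by auto
        moreover have "S (t - real n) x \<in> K" using T(2)[of "t - real n"] t x by auto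
        ultimately show ?thesis using n unfolding F_def by auto
      qed
      then have "(SUP x\<in>D. ennreal (infdist (S t x) A)) \<le> b"
        unfolding eps(2)[symmetric] by (intro SUP_least ennreal_leI) (simp add: less_imp_le)
      then show "(SUP x\<in>D. ennreal (infdist (S t x) A)) < a" using b(2) by simp
    qed
  qed simp
  have "S t ` A = A" if "t \<ge> 0" for t
    using forward[OF that] backward[OF that] by blast
  then have "compact_global_attractor S X A"
    unfolding compact_global_attractor_def using A_ne A_compact A_sub attract by blast
  then show ?thesis unfolding A_def F_def .
qed

text \<open>Gronwall: the function \<open>E t exp (c t)\<close> has nonpositive derivative.\<close>

lemma exponential_decay:
  fixes E :: "real \<Rightarrow> real"
  assumes E: "\<And>t. t \<ge> 0 \<Longrightarrow> \<exists>D. (E has_real_derivative D) (at t within {0..}) \<and> D \<le> - c * E t"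
    and t: "t \<ge> 0"
  shows "E t \<le> E 0 * exp (- c * t)"
proof (cases "t = 0")
  case False
  then have t0: "0 < t" using t by simp
  obtain D where D: "\<And>s. s \<ge> 0 \<Longrightarrow> (E has_real_derivative D s) (at s within {0..})"
    and Dle: "\<And>s. s \<ge> 0 \<Longrightarrow> D s \<le> - c * E s"
    using E by metis
  let ?\<phi> = "\<lambda>s. E s * exp (c * s)"
  have "(?\<phi> has_derivative (*) ((D s + c * E s) * exp (c * s))) (at s within {0..t})" if "0 \<le> s" for s
  proof -
    have "(?\<phi> has_real_derivative (D s * exp (c * s) + c * exp (c * s) * E s)) (at s within {0..t})"
      by (intro DERIV_mult DERIV_subset[OF D[OF that]]) (auto intro!: derivative_eq_intros)
    then have "(?\<phi> has_real_derivative ((D s + c * E s) * exp (c * s))) (at s within {0..t})"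
      by (simp add: algebra_simps)
    then show ?thesis
      unfolding has_field_derivative_def .
  qed
  from mvt_simple[OF t0 this] obtain s where s: "0 < s"
    and eq: "?\<phi> t - ?\<phi> 0 = (D s + c * E s) * exp (c * s) * (t - 0)" by force
  have "(D s + c * E s) * exp (c * s) \<le> 0"
    using Dle[of s] s by (intro mult_nonpos_nonneg) auto
  then have "?\<phi> t - ?\<phi> 0 \<le> 0"
    unfolding eq by (rule mult_nonpos_nonneg) (use t in simp)
  then have "E t * exp (c * t) \<le> E 0" by simp
  then show ?thesis by (simp add: exp_minus divide_inverse[symmetric] pos_le_divide_eq)
qed simp

section \<open>Hodge decomposition of the divergence-free edge cochains\<close>

text \<open>The cochains dual to the single cells span.\<close>

lemma cochain_space_finite_rank:
  fixes val :: "'c::real_inner \<Rightarrow> 'a \<Rightarrow> real"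
  assumes "cochain_space A val" "finite A"
  shows "finite_rank (UNIV :: 'c set)"
proof -
  have L: "linear (\<lambda>c. val c a)" for a
    using assms(1) unfolding cochain_space_def by blast
  have ran: "range val = {\<phi>. \<forall>a. a \<notin> A \<longrightarrow> \<phi> a = 0}"
    using assms(1) unfolding cochain_space_def bij_betw_def by blast
  have "\<exists>c. val c = (\<lambda>b. of_bool (b = a))" if "a \<in> A" for a
  proof -
    have "(\<lambda>b. of_bool (b = a) :: real) \<in> range val" unfolding ran using that by auto
    then show ?thesis by (auto simp: image_iff)
  qed
  then obtain \<delta> where \<delta>: "\<And>a. a \<in> A \<Longrightarrow> val (\<delta> a) = (\<lambda>b. of_bool (b = a))"
    by metis
  have "c \<in> span (\<delta> ` A)" for c
  proof -
    have "val c b = val (\<Sum>a\<in>A. val c a *\<^sub>R \<delta> a) b" if "b \<in> A" for b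
    proof -
      have "val (\<Sum>a\<in>A. val c a *\<^sub>R \<delta> a) b = (\<Sum>a\<in>A. val c a * of_bool (b = a))"
        by (simp add: linear_sum[OF L] linear_scale[OF L] \<delta>)
      also have "\<dots> = (\<Sum>a\<in>A. if a = b then val c b else 0)"
        by (intro sum.cong) auto
      also have "\<dots> = val c b" using that assms(2) by simp
      finally show ?thesis by simp
    qed
    then have eq: "c = (\<Sum>a\<in>A. val c a *\<^sub>R \<delta> a)"
      by (rule cochain_space_eqI[OF assms(1)])
    show ?thesis
      by (subst eq) (intro span_sum span_scale span_base imageI)
  qed
  then show ?thesis
    unfolding finite_rank_def using assms(2) by blast
qed

locale hodge_complex =
  fixes d0 :: "'c0::real_inner \<Rightarrow> 'c1::real_inner" and d1 :: "'c1 \<Rightarrow> 'c2::real_inner"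
  assumes lin0: "linear d0" and lin1: "linear d1"
    and d1_d0: "\<And>p. d1 (d0 p) = 0"
    and fin0: "finite_rank (UNIV :: 'c0 set)" and fin1: "finite_rank (UNIV :: 'c1 set)"
begin

abbreviation "V \<equiv> divfree d0"
abbreviation "H \<equiv> harmonic1 d0 d1"
abbreviation "V0 \<equiv> divfree_nonharm d0 d1"
abbreviation "Lap \<equiv> laplace1 d0 d1"
abbreviation "Q \<equiv> projQ d0 d1"
abbreviation "P0 \<equiv> projP0 d0 d1"

lemma adj0: "d0 p \<bullet> a = p \<bullet> adjoint d0 a"
  by (rule adjoint_finite_rank[OF lin0 fin0])

lemma adj1: "d1 a \<bullet> b = a \<bullet> adjoint d1 b"
  by (rule adjoint_finite_rank[OF lin1 fin1])

lemma lin_adj0: "linear (adjoint d0)" and lin_adj1: "linear (adjoint d1)"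
  by (rule adjoint_linear_finite_rank[OF lin0 fin0], rule adjoint_linear_finite_rank[OF lin1 fin1])

lemma Lap_inner: "Lap x \<bullet> y = adjoint d0 x \<bullet> adjoint d0 y + d1 x \<bullet> d1 y"
  unfolding laplace1_def inner_add_left adj0 inner_commute[of "adjoint d1 (d1 x)"] adj1[symmetric]
  by (simp add: inner_commute)

lemma Lap_sym: "Lap x \<bullet> y = x \<bullet> Lap y"
  unfolding inner_commute[of x] Lap_inner by (simp add: inner_commute)

lemma Lap_psd: "0 \<le> Lap x \<bullet> x"
  unfolding Lap_inner by simp

lemma Lap_linear: "linear Lap"
  unfolding laplace1_def[abs_def]
  by (intro linear_compose_add linear_compose[unfolded o_def, OF lin_adj0 lin0]
      linear_compose[unfolded o_def, OF lin1 lin_adj1])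

lemma subspace_V: "subspace V"
  unfolding divfree_def by (rule linear_subspace_kernel[OF lin_adj0])

lemma subspace_H: "subspace H"
  unfolding harmonic1_def
  by (intro subspace_inter subspace_V linear_subspace_kernel[OF Lap_linear])

lemma subspace_V0: "subspace V0"
  unfolding divfree_nonharm_def by (intro subspace_inter subspace_V subspace_orthogonal_comp)

lemma finite_rank_any: "finite_rank (W :: 'c1 set)"
  by (rule finite_rank_subset[OF fin1]) simp

lemma H_sub_V: "H \<subseteq> V" and V0_sub_V: "V0 \<subseteq> V"
  unfolding harmonic1_def divfree_nonharm_def by auto

lemma Lap_H: "w \<in> H \<Longrightarrow> Lap w = 0"
  unfolding harmonic1_def by simp

lemma V0_iff: "x \<in> V0 \<longleftrightarrow> x \<in> V \<and> (\<forall>w\<in>H. x \<bullet> w = 0)"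
  unfolding divfree_nonharm_def orthogonal_comp_def orthogonal_def by (auto simp: inner_commute)

text \<open>On \<open>V\<close> only the curl part of the Laplacian survives, and it is again divergence free because
  \<open>d0\<^sup>* d1\<^sup>* = (d1 d0)\<^sup>* = 0\<close>; its range is orthogonal to the kernel by self-adjointness.\<close>

lemma Lap_V0: assumes "x \<in> V" shows "Lap x \<in> V0"
proof -
  have "adjoint d0 (adjoint d1 b) = 0" for b
  proof -
    have "p \<bullet> adjoint d0 (adjoint d1 b) = 0" for p
      by (simp add: adj0[symmetric] adj1[symmetric] d1_d0)
    from this[of "adjoint d0 (adjoint d1 b)"] show ?thesis by simp
  qed
  then have "Lap x \<in> V"
    using assms by (simp add: divfree_def laplace1_def linear_0[OF lin0])
  then show ?thesis unfolding V0_iff by (simp add: Lap_sym Lap_H)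
qed

lemma Q_mem: "Q x \<in> H" and Q_residual: "w \<in> H \<Longrightarrow> (x - Q x) \<bullet> w = 0"
  by (rule orth_proj_mem[OF subspace_H finite_rank_any],
      rule orth_proj_residual[OF subspace_H finite_rank_any])

lemma P0_V0: assumes "x \<in> V" shows "P0 x \<in> V0"
  unfolding V0_iff projP0_def using assms Q_mem[of x] H_sub_V Q_residual
  by (auto intro: subspace_diff[OF subspace_V])

lemma Q_eqI: assumes "w \<in> H" "x - w \<in> V0" shows "Q x = w"
  by (rule orth_proj_eqI[OF subspace_H assms(1)]) (use assms(2) V0_iff in blast)

lemma P0_inner: assumes "w \<in> V0" shows "P0 x \<bullet> w = x \<bullet> w"
proof -
  have "Q x \<bullet> w = 0" using assms Q_mem[of x] V0_iff[of w] by (metis inner_commute)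
  then show ?thesis unfolding projP0_def by (simp add: inner_diff_left)
qed

text \<open>The fibre over \<open>uH\<close> is the translate \<open>uH + V0\<close>. On it the complementary variable is the plain
  difference \<open>u - uH\<close>, so it can be differentiated in time without differentiating a projection.\<close>

lemma affine_fibre_iff:
  assumes "uH \<in> H"
  shows "u \<in> V \<and> Q u = uH \<longleftrightarrow> u - uH \<in> V0"
proof
  assume "u \<in> V \<and> Q u = uH"
  then show "u - uH \<in> V0" using P0_V0[of u] unfolding projP0_def by simp
next
  assume d: "u - uH \<in> V0"
  then have "(u - uH) + uH \<in> V"
    using assms H_sub_V V0_sub_V by (intro subspace_add[OF subspace_V]) auto
  then show "u \<in> V \<and> Q u = uH" using Q_eqI[OF assms d] by simp
qed

text \<open>The minimum of the Rayleigh quotient on \<open>V0\<close> is attained at an eigenvector, hence is positive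
  since \<open>V0\<close> meets the harmonic space trivially. It is the least positive eigenvalue on all of
  \<open>V\<close> because an eigenvector with nonzero eigenvalue lies in the range of the Laplacian, which is
  contained in \<open>V0\<close>.\<close>

lemma lambda_plus_gap:
  assumes "V0 \<noteq> {0}"
  shows "0 < lambda_plus d0 d1" and "\<forall>x\<in>V0. lambda_plus d0 d1 * (x \<bullet> x) \<le> Lap x \<bullet> x"
proof -
  obtain e m where e: "e \<in> V0" "norm e = 1" "Lap e = m *\<^sub>R e"
    and ray: "\<forall>x\<in>V0. m * (x \<bullet> x) \<le> Lap x \<bullet> x"
    using rayleigh_minimizer[OF Lap_linear subspace_V0 finite_rank_any assms _ Lap_sym]
      Lap_V0 V0_sub_V by blast
  have ee: "e \<bullet> e = 1" using e(2) by (simp add: dot_square_norm)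
  have "m \<noteq> 0"
  proof
    assume "m = 0"
    then have "e \<in> H" using e V0_sub_V unfolding harmonic1_def by auto
    then show False using e(1) ee unfolding V0_iff by simp
  qed
  moreover have "0 \<le> m" using Lap_psd[of e] ee unfolding e(3) by simp
  ultimately have m: "0 < m" by simp
  have "lambda_plus d0 d1 = m"
    unfolding lambda_plus_def
  proof (rule Least_equality)
    show "0 < m \<and> eigenvalue_on V Lap m"
      unfolding eigenvalue_on_def using m e V0_sub_V by (intro conjI bexI[of _ e]) auto
    fix l assume "0 < l \<and> eigenvalue_on V Lap l"
    then obtain a where l: "0 < l" and a: "a \<in> V" "a \<noteq> 0" "Lap a = l *\<^sub>R a"
      unfolding eigenvalue_on_def by blast
    have "(1 / l) *\<^sub>R Lap a \<in> V0" using Lap_V0[OF a(1)] by (rule subspace_scale[OF subspace_V0])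
    then have "a \<in> V0" using a(3) l by simp
    then have "m * (a \<bullet> a) \<le> l * (a \<bullet> a)" using ray a(3) by fastforce
    moreover have "a \<bullet> a > 0" using a(2) by simp
    ultimately show "m \<le> l" by simp
  qed
  then show "0 < lambda_plus d0 d1" and "\<forall>x\<in>V0. lambda_plus d0 d1 * (x \<bullet> x) \<le> Lap x \<bullet> x"
    using m ray by simp_all
qed

lemma spectral_gap: "\<exists>l>0. \<forall>x\<in>V0. l * (x \<bullet> x) \<le> Lap x \<bullet> x"
proof (cases "V0 = {0}")
  case True
  then show ?thesis by (intro exI[of _ 1]) simp
next
  case False
  then show ?thesis using lambda_plus_gap by blast
qed

lemma norm_op_sqrt_Lap: "(norm (op_sqrt Lap x))\<^sup>2 = Lap x \<bullet> x"
proof -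
  note R = op_sqrt_works[OF Lap_linear fin1 Lap_sym Lap_psd]
  have "(norm (op_sqrt Lap x))\<^sup>2 = op_sqrt Lap (op_sqrt Lap x) \<bullet> x"
    using R by (simp add: power2_norm_eq_inner)
  also have "op_sqrt Lap (op_sqrt Lap x) = Lap x" using R by (metis comp_apply)
  finally show ?thesis .
qed

end

section \<open>Energy balance, invariant fibres and decay\<close>

locale cochain_mhd = hodge_complex d0 d1
  for d0 :: "'c0::real_inner \<Rightarrow> 'c1::real_inner" and d1 :: "'c1 \<Rightarrow> 'c2::real_inner" +
  fixes B :: "'c1 \<Rightarrow> 'c1 \<Rightarrow> 'c1" and \<nu> \<eta> :: real and f g uH hH :: 'c1
  assumes bilin: "bilinear_on (divfree d0) B"
    and skew: "\<And>a b c. a \<in> divfree d0 \<Longrightarrow> b \<in> divfree d0 \<Longrightarrow> c \<in> divfree d0 \<Longrightarrow>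
                 B a b \<bullet> c = - (B a c \<bullet> b)"
    and pos: "\<nu> > 0" "\<eta> > 0"
    and forcing: "projQ d0 d1 (projP d0 f) = 0" "projQ d0 d1 (projP d0 g) = 0"
    and harm: "uH \<in> harmonic1 d0 d1" "hH \<in> harmonic1 d0 d1"
begin

abbreviation "field \<equiv> mhd_field d0 d1 B \<nu> \<eta> f g"
abbreviation "X \<equiv> fibre d0 d1 uH hH"
abbreviation "solves u h \<equiv> solution_in (V \<times> V) field (\<lambda>t. (u t, h t))"

lemma forcing_P0: "P0 (projP d0 f) = projP d0 f" "P0 (projP d0 g) = projP d0 g"
  unfolding projP0_def by (simp_all add: forcing)

lemma forcing_V0: "projP d0 f \<in> V0" "projP d0 g \<in> V0"
  using P0_V0[of "projP d0 f"] P0_V0[of "projP d0 g"] orth_proj_mem[OF subspace_V finite_rank_any]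
  unfolding forcing_P0 by blast+

lemma fibre_iff: "(u, h) \<in> X \<longleftrightarrow> u - uH \<in> V0 \<and> h - hH \<in> V0"
  unfolding fibre_def affine_fibre_iff[OF harm(1), symmetric] affine_fibre_iff[OF harm(2), symmetric]
  by auto

lemma fibre_P0: assumes "(u, h) \<in> X" shows "P0 u = u - uH" "P0 h = h - hH"
  using assms unfolding fibre_def projP0_def by auto

lemma fibre_sub: "X \<subseteq> V \<times> V"
  unfolding fibre_def by auto

lemma B_mem: "a \<in> V \<Longrightarrow> b \<in> V \<Longrightarrow> B a b \<in> V"
  using bilin unfolding bilinear_on_def by blast

lemma B0_V0: assumes "a \<in> V" "b \<in> V" shows "B0 d0 d1 B a b \<in> V0"
  unfolding B0_def using P0_V0[OF assms(1)] P0_V0[OF assms(2)] V0_sub_V by (intro P0_V0 B_mem) auto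

lemma field_V0: assumes "u \<in> V" "h \<in> V" shows "fst (field (u, h)) \<in> V0" "snd (field (u, h)) \<in> V0"
  unfolding mhd_field_def using assms
  by (auto intro!: subspace_add[OF subspace_V0] subspace_diff[OF subspace_V0] subspace_neg[OF subspace_V0]
      subspace_scale[OF subspace_V0] Lap_V0 B0_V0 forcing_V0)

text \<open>Skew symmetry kills the self-transport terms \<open>B(u0,u0) \<bullet> u0\<close> and \<open>B(u0,h0) \<bullet> h0\<close>, and makes the
  two exchange terms \<open>B(h0,h0) \<bullet> u0\<close> and \<open>B(h0,u0) \<bullet> h0\<close> cancel between the equations. The harmonic
  part of the state enters neither the dissipation nor the nonlinearity.\<close>

lemma field_energy:
  assumes "(u, h) \<in> X"
  shows "fst (field (u, h)) \<bullet> (u - uH) + snd (field (u, h)) \<bullet> (h - hH)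
       = projP d0 f \<bullet> (u - uH) + projP d0 g \<bullet> (h - hH)
         - \<nu> * (Lap (u - uH) \<bullet> (u - uH)) - \<eta> * (Lap (h - hH) \<bullet> (h - hH))"
proof -
  define a b where "a = u - uH" and "b = h - hH"
  have a: "a \<in> V0" "P0 u = a" and b: "b \<in> V0" "P0 h = b"
    using assms fibre_iff[of u h] fibre_P0[OF assms] unfolding a_def b_def by auto
  have V: "a \<in> V" "b \<in> V" using a b V0_sub_V by auto
  have Lu: "Lap u = Lap a" and Lh: "Lap h = Lap b"
    unfolding a_def b_def by (simp_all add: linear_diff[OF Lap_linear] Lap_H harm)
  have "B a a \<bullet> a = 0" using skew[of a a a] V by simp
  moreover have "B a b \<bullet> b = 0" using skew[of a b b] V by simp
  moreover have "B b b \<bullet> a = - (B b a \<bullet> b)" using skew[of b b a] V by simp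
  ultimately show ?thesis
    unfolding a_def[symmetric] b_def[symmetric] mhd_field_def B0_def
    by (simp add: a b Lu Lh inner_add_left inner_diff_left P0_inner)
qed

lemma solution_derivatives:
  assumes "solves u h" "t \<ge> 0"
  shows "u t \<in> V" "h t \<in> V"
    and "(u has_vector_derivative fst (field (u t, h t))) (at t within {0..})"
    and "(h has_vector_derivative snd (field (u t, h t))) (at t within {0..})"
proof -
  have s: "(u t, h t) \<in> V \<times> V"
    "((\<lambda>t. (u t, h t)) has_vector_derivative field (u t, h t)) (at t within {0..})"
    using assms unfolding solution_in_def by auto
  show "u t \<in> V" "h t \<in> V" using s(1) by auto
  show "(u has_vector_derivative fst (field (u t, h t))) (at t within {0..})"
    using bounded_linear.has_vector_derivative[OF bounded_linear_fst s(2)] by simp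
  show "(h has_vector_derivative snd (field (u t, h t))) (at t within {0..})"
    using bounded_linear.has_vector_derivative[OF bounded_linear_snd s(2)] by simp
qed

text \<open>This is applied to the two components of a solution: the vector field takes values in
  \<open>V0 \<times> V0\<close>, which is orthogonal to the harmonic cochains.\<close>

lemma constant_harmonic_component:
  assumes x: "\<And>t. t \<ge> 0 \<Longrightarrow> (x has_vector_derivative x' t) (at t within {0..})"
    and x': "\<And>t. t \<ge> 0 \<Longrightarrow> x' t \<in> V0" and w: "w \<in> H" and t: "t \<ge> (0::real)"
  shows "x t \<bullet> w = x 0 \<bullet> w"
proof -
  have "((\<lambda>s. x s \<bullet> w) has_field_derivative 0) (at s within {0..})" if "s \<in> {0..}" for s
    using bounded_linear.has_vector_derivative[OF bounded_linear_inner_left x[of s], of w]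
      x'[of s] w that unfolding V0_iff has_real_derivative_iff_has_vector_derivative by simp
  then obtain c where "\<And>s. s \<in> {0..} \<Longrightarrow> x s \<bullet> w = c"
    using has_field_derivative_zero_constant[of "{0::real..}" "\<lambda>s. x s \<bullet> w"] by auto
  then show ?thesis using t by simp
qed

lemma fibre_invariant:
  assumes sol: "solves u h" and init: "(u 0, h 0) \<in> X" and t: "t \<ge> 0"
  shows "(u t, h t) \<in> X"
proof -
  note d = solution_derivatives[OF sol]
  have V: "u t - uH \<in> V" "h t - hH \<in> V"
    using d(1,2)[OF t] harm H_sub_V by (auto intro: subspace_diff[OF subspace_V])
  have "u t \<bullet> w = u 0 \<bullet> w" "h t \<bullet> w = h 0 \<bullet> w" if w: "w \<in> H" for w
    by (rule constant_harmonic_component[OF d(3) field_V0(1)[OF d(1,2)] w t]; assumption)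
       (rule constant_harmonic_component[OF d(4) field_V0(2)[OF d(1,2)] w t]; assumption)
  then show ?thesis
    using V init unfolding fibre_iff V0_iff by (simp add: inner_diff_left)
qed

lemma energy_balance:
  assumes sol: "solves u h" and init: "(u 0, h 0) \<in> X" and t: "t \<ge> 0"
  shows "((\<lambda>s. (norm (u s - uH))\<^sup>2 + (norm (h s - hH))\<^sup>2) has_real_derivative
     2 * (projP d0 f \<bullet> (u t - uH) + projP d0 g \<bullet> (h t - hH)
          - \<nu> * (Lap (u t - uH) \<bullet> (u t - uH)) - \<eta> * (Lap (h t - hH) \<bullet> (h t - hH))))
     (at t within {0..})"
proof -
  note d = solution_derivatives[OF sol t]
  have sq: "((\<lambda>s. (norm (x s - w))\<^sup>2) has_real_derivative 2 * (x' \<bullet> (x t - w))) (at t within {0..})"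
    if "(x has_vector_derivative x') (at t within {0..})" for x :: "real \<Rightarrow> 'c1" and x' w
  proof -
    have x: "((\<lambda>s. x s - w) has_vector_derivative x') (at t within {0..})"
      using has_vector_derivative_diff[OF that has_vector_derivative_const] by simp
    show ?thesis
      using bounded_bilinear.has_vector_derivative[OF bounded_bilinear_inner x x]
      unfolding power2_norm_eq_inner has_real_derivative_iff_has_vector_derivative
      by (simp add: inner_commute)
  qed
  show ?thesis
    using DERIV_add[OF sq[OF d(3), of uH] sq[OF d(4), of hH]]
    unfolding distrib_left[symmetric] field_energy[OF fibre_invariant[OF assms]] .
qed

lemma dissipation_bound:
  assumes gap: "\<forall>x\<in>V0. l * (x \<bullet> x) \<le> Lap x \<bullet> x" and l: "l > 0" and ab: "a \<in> V0" "b \<in> V0"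
  shows "min \<nu> \<eta> * l * ((norm a)\<^sup>2 + (norm b)\<^sup>2) \<le> \<nu> * (Lap a \<bullet> a) + \<eta> * (Lap b \<bullet> b)"
proof -
  have "min \<nu> \<eta> * (l * (a \<bullet> a)) \<le> \<nu> * (Lap a \<bullet> a)"
    using gap ab l pos by (intro mult_mono) (auto intro!: mult_nonneg_nonneg)
  moreover have "min \<nu> \<eta> * (l * (b \<bullet> b)) \<le> \<eta> * (Lap b \<bullet> b)"
    using gap ab l pos by (intro mult_mono) (auto intro!: mult_nonneg_nonneg)
  ultimately show ?thesis by (simp add: power2_norm_eq_inner algebra_simps)
qed

lemma young_inner:
  fixes x y :: "'a::real_inner"
  assumes "c > (0::real)"
  shows "2 * (x \<bullet> y) \<le> c * (norm y)\<^sup>2 + (norm x)\<^sup>2 / c"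
proof -
  have "0 \<le> (norm (c *\<^sub>R y - x))\<^sup>2 / c" using assms by simp
  also have "(norm (c *\<^sub>R y - x))\<^sup>2 = c * (c * (norm y)\<^sup>2 - 2 * (x \<bullet> y)) + (norm x)\<^sup>2"
    unfolding power2_norm_eq_inner
    by (simp add: inner_diff_left inner_diff_right inner_commute algebra_simps)
  also have "\<dots> / c = c * (norm y)\<^sup>2 - 2 * (x \<bullet> y) + (norm x)\<^sup>2 / c"
    using assms by (simp add: add_divide_distrib)
  finally show ?thesis by simp
qed

text \<open>By Young's inequality half of the dissipation absorbs the forcing, so the energy relaxes
  exponentially to at most the level \<open>k / c\<close>; the decay estimate is applied to the excess of the
  energy over that level.\<close>

lemma forced_energy_bound:
  assumes gap: "\<forall>x\<in>V0. l * (x \<bullet> x) \<le> Lap x \<bullet> x" and l: "l > 0"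
    and sol: "solves u h" and init: "(u 0, h 0) \<in> X" and t: "t \<ge> 0"
  defines "c \<equiv> min \<nu> \<eta> * l"
  defines "k \<equiv> ((norm (projP d0 f))\<^sup>2 + (norm (projP d0 g))\<^sup>2) / c"
  shows "(norm (u t - uH))\<^sup>2 + (norm (h t - hH))\<^sup>2 - k / c
     \<le> ((norm (u 0 - uH))\<^sup>2 + (norm (h 0 - hH))\<^sup>2 - k / c) * exp (- c * t)"
proof -
  have c: "c > 0" unfolding c_def using l pos by simp
  let ?E = "\<lambda>s. (norm (u s - uH))\<^sup>2 + (norm (h s - hH))\<^sup>2"
  have "\<exists>D. ((\<lambda>s. ?E s - k / c) has_real_derivative D) (at s within {0..}) \<and> D \<le> - c * (?E s - k / c)"
    if s: "s \<ge> 0" for s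
  proof -
    let ?a = "u s - uH" and ?b = "h s - hH"
    let ?D = "2 * (projP d0 f \<bullet> ?a + projP d0 g \<bullet> ?b - \<nu> * (Lap ?a \<bullet> ?a) - \<eta> * (Lap ?b \<bullet> ?b))"
    have der: "((\<lambda>s. ?E s - k / c) has_real_derivative ?D) (at s within {0..})"
      using DERIV_diff[OF energy_balance[OF sol init s] DERIV_const] by simp
    have ab: "?a \<in> V0" "?b \<in> V0" using fibre_invariant[OF sol init s] unfolding fibre_iff by auto
    have dis: "c * ?E s \<le> \<nu> * (Lap ?a \<bullet> ?a) + \<eta> * (Lap ?b \<bullet> ?b)"
      unfolding c_def by (rule dissipation_bound[OF gap l ab])
    have "?D \<le> (c * (norm ?a)\<^sup>2 + (norm (projP d0 f))\<^sup>2 / c)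
        + (c * (norm ?b)\<^sup>2 + (norm (projP d0 g))\<^sup>2 / c) - 2 * (c * ?E s)"
      using young_inner[OF c, of "projP d0 f" ?a] young_inner[OF c, of "projP d0 g" ?b] dis by argo
    also have "\<dots> = - c * ?E s + k"
      unfolding k_def by (simp add: algebra_simps add_divide_distrib)
    also have "\<dots> = - c * (?E s - k / c)" using c by (simp add: field_simps)
    finally show ?thesis using der by blast
  qed
  from exponential_decay[OF this t] show ?thesis .
qed

lemma unforced_energy_decay:
  assumes gap: "\<forall>x\<in>V0. l * (x \<bullet> x) \<le> Lap x \<bullet> x" and l: "l > 0"
    and sol: "solves u h" and init: "(u 0, h 0) \<in> X" and t: "t \<ge> 0" and zero: "f = 0" "g = 0"
  shows "(norm (u t - uH))\<^sup>2 + (norm (h t - hH))\<^sup>2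
     \<le> ((norm (u 0 - uH))\<^sup>2 + (norm (h 0 - hH))\<^sup>2) * exp (- (2 * (min \<nu> \<eta> * l)) * t)"
proof -
  let ?E = "\<lambda>s. (norm (u s - uH))\<^sup>2 + (norm (h s - hH))\<^sup>2"
  have P0: "projP d0 0 = 0"
    by (rule orth_proj_eqI[OF subspace_V subspace_0[OF subspace_V]]) simp
  have "\<exists>D. (?E has_real_derivative D) (at s within {0..}) \<and> D \<le> - (2 * (min \<nu> \<eta> * l)) * ?E s"
    if s: "s \<ge> 0" for s
  proof -
    have ab: "u s - uH \<in> V0" "h s - hH \<in> V0"
      using fibre_invariant[OF sol init s] unfolding fibre_iff by auto
    show ?thesis
      by (intro exI conjI, rule energy_balance[OF sol init s])
         (use dissipation_bound[OF gap l ab] in \<open>simp add: zero P0\<close>)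
  qed
  from exponential_decay[OF this t] show ?thesis .
qed

lemma unforced_convergence:
  assumes sol: "solves u h" and init: "(u 0, h 0) \<in> X" and zero: "f = 0" "g = 0"
  shows "((\<lambda>t. (u t, h t)) \<longlongrightarrow> (uH, hH)) at_top"
proof -
  obtain l where l: "l > 0" "\<forall>x\<in>V0. l * (x \<bullet> x) \<le> Lap x \<bullet> x" using spectral_gap by blast
  define E where "E s = (norm (u s - uH))\<^sup>2 + (norm (h s - hH))\<^sup>2" for s
  define c where "c = 2 * (min \<nu> \<eta> * l)"
  have c: "c > 0" unfolding c_def using l pos by simp
  have lim: "((\<lambda>t. E 0 * exp (- c * t)) \<longlongrightarrow> 0) at_top"
    using c by real_asymp
  have "(E \<longlongrightarrow> 0) at_top"
  proof (rule tendsto_sandwich[OF _ _ tendsto_const lim])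
    show "eventually (\<lambda>t. 0 \<le> E t) at_top" by (simp add: E_def)
    show "eventually (\<lambda>t. E t \<le> E 0 * exp (- c * t)) at_top"
      using eventually_ge_at_top[of 0]
      by eventually_elim (use unforced_energy_decay[OF l(2,1) sol init _ zero] in \<open>simp add: E_def c_def\<close>)
  qed
  then have "((\<lambda>t. sqrt (E t)) \<longlongrightarrow> 0) at_top" using tendsto_real_sqrt[of E 0] by simp
  moreover have "sqrt (E t) = dist (u t, h t) (uH, hH)" for t
    unfolding E_def by (simp add: dist_norm norm_Pair)
  ultimately show ?thesis by (subst tendsto_dist_iff) simp
qed

text \<open>The intersection is a translate of a closed part of a product of two compact balls of \<open>V0\<close>.\<close>

lemma compact_fibre_cball: "compact (X \<inter> cball (uH, hH) r)"
proof -
  let ?C = "(V0 \<inter> cball 0 r) \<times> (V0 \<inter> cball 0 r) \<inter> cball 0 r"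
  have "compact ?C"
    by (intro compact_Int_closed compact_Times compact_finite_rank_cball subspace_V0 finite_rank_any
        closed_cball)
  then have "compact ((\<lambda>p. (uH, hH) + p) ` ?C)"
    by (intro compact_continuous_image continuous_intros)
  moreover have "(\<lambda>p. (uH, hH) + p) ` ?C = X \<inter> cball (uH, hH) r"
  proof (intro equalityI subsetI)
    fix p assume "p \<in> (\<lambda>p. (uH, hH) + p) ` ?C"
    then show "p \<in> X \<inter> cball (uH, hH) r" by (auto simp: fibre_iff dist_norm norm_Pair)
  next
    fix p assume p: "p \<in> X \<inter> cball (uH, hH) r"
    obtain u h where uh: "p = (u, h)" by (cases p)
    have d: "norm (u - uH, h - hH) \<le> r"
      using p unfolding uh by (simp add: dist_norm norm_Pair norm_minus_commute)
    then have "norm (u - uH) \<le> r" "norm (h - hH) \<le> r"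
      using norm_fst_le[of "u - uH" "h - hH"] norm_snd_le[of "h - hH" "u - uH"] by linarith+
    then show "p \<in> (\<lambda>p. (uH, hH) + p) ` ?C"
      using p d unfolding uh by (intro image_eqI[of _ _ "(u - uH, h - hH)"]) (auto simp: fibre_iff)
  qed
  ultimately show ?thesis by simp
qed

text \<open>Let \<open>m\<close> be the energy level of lemma \<open>forced_energy_bound\<close>. The absorbing set is the ball of
  squared radius \<open>m + 1\<close> in the fibre: there the excess of the energy over \<open>m\<close> is at most one and
  cannot grow past one, while the excess on a bounded set decays below one uniformly.\<close>

lemma fibre_attractor:
  assumes gen: "generates_semiflow (V \<times> V) field S"
  shows "positively_invariant S X" and "\<exists>A. compact_global_attractor S X A"
proof -
  have sf: "continuous_semiflow_on (V \<times> V) S"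
    and solS: "\<And>p. p \<in> V \<times> V \<Longrightarrow> solves (\<lambda>t. fst (S t p)) (\<lambda>t. snd (S t p))"
    using gen unfolding generates_semiflow_def by auto
  have S0: "S 0 p = p" if "p \<in> X" for p
    using sf that fibre_sub unfolding continuous_semiflow_on_def by blast
  have orbit: "solves (\<lambda>t. fst (S t p)) (\<lambda>t. snd (S t p))" "(fst (S 0 p), snd (S 0 p)) \<in> X"
    if "p \<in> X" for p
    using solS[of p] fibre_sub S0[OF that] that by auto
  have invX: "S t p \<in> X" if "t \<ge> 0" "p \<in> X" for t p
    using fibre_invariant[OF orbit[OF that(2)] that(1)] by simp
  then show "positively_invariant S X" unfolding positively_invariant_def by auto
  have sfX: "continuous_semiflow_on X S"
    using sf invX fibre_sub unfolding continuous_semiflow_on_def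
    by (auto intro: continuous_on_subset[of "{0..} \<times> (V \<times> V)"])
  obtain l where l: "l > 0" "\<forall>x\<in>V0. l * (x \<bullet> x) \<le> Lap x \<bullet> x" using spectral_gap by blast
  define c where "c = min \<nu> \<eta> * l"
  define m where "m = ((norm (projP d0 f))\<^sup>2 + (norm (projP d0 g))\<^sup>2) / c / c"
  have c: "c > 0" unfolding c_def using l pos by simp
  have m: "m \<ge> 0" unfolding m_def using c by simp
  define E where "E p = (norm (p - (uH, hH)))\<^sup>2" for p
  have E_Pair: "E p = (norm (fst p - uH))\<^sup>2 + (norm (snd p - hH))\<^sup>2" for p
    unfolding E_def by (cases p) (simp add: norm_Pair)
  have decay: "E (S t p) - m \<le> (E p - m) * exp (- c * t)" if "t \<ge> 0" "p \<in> X" for t p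
    using forced_energy_bound[OF l(2,1) orbit[OF that(2)] that(1)] S0[OF that(2)]
    unfolding E_Pair m_def c_def by simp
  define K where "K = X \<inter> cball (uH, hH) (sqrt (m + 1))"
  have K_iff: "p \<in> K \<longleftrightarrow> p \<in> X \<and> E p \<le> m + 1" for p
  proof -
    have "dist (uH, hH) p = sqrt (E p)" unfolding E_def by (simp add: dist_norm norm_minus_commute)
    then show ?thesis unfolding K_def by simp
  qed
  have "(uH, hH) \<in> K"
    unfolding K_iff fibre_iff E_def using m by (simp add: subspace_0[OF subspace_V0])
  then have K_ne: "K \<noteq> {}" by blast
  have K_inv: "positively_invariant S K"
    unfolding positively_invariant_def
  proof (intro allI impI image_subsetI)
    fix t p assume t: "(0::real) \<le> t" and p: "p \<in> K"
    have "(E p - m) * exp (- c * t) \<le> 1 * exp (- c * t)"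
      using p unfolding K_iff by (intro mult_right_mono) auto
    also have "\<dots> \<le> 1" using t c by simp
    finally show "S t p \<in> K" using decay[OF t, of p] invX[OF t, of p] p unfolding K_iff by auto
  qed
  have absorb: "\<exists>T\<ge>0. \<forall>t\<ge>T. S t ` D \<subseteq> K" if D: "D \<subseteq> X" "bounded D" for D
  proof -
    obtain b where b: "\<And>p. p \<in> D \<Longrightarrow> norm p \<le> b" using D(2) unfolding bounded_iff by blast
    define M where "M = (b + norm (uH, hH))\<^sup>2"
    have M: "E p \<le> M" if "p \<in> D" for p
      unfolding E_def M_def using b[OF that] norm_triangle_ineq4[of p "(uH, hH)"]
      by (intro power_mono) auto
    have M0: "M \<ge> 0" unfolding M_def by simp
    have "((\<lambda>t. M * exp (- c * t)) \<longlongrightarrow> 0) at_top" using c by real_asymp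
    then have "eventually (\<lambda>t. M * exp (- c * t) < 1) at_top" by (rule order_tendstoD) simp
    then obtain T where T: "\<And>t. t \<ge> T \<Longrightarrow> M * exp (- c * t) < 1"
      unfolding eventually_at_top_linorder by blast
    have "S t p \<in> K" if t: "t \<ge> max 0 T" and p: "p \<in> D" for t p
    proof -
      have pX: "p \<in> X" and t0: "t \<ge> 0" using p D(1) t by auto
      have "(E p - m) * exp (- c * t) \<le> M * exp (- c * t)"
        using M[OF p] m by (intro mult_right_mono) auto
      also have "\<dots> \<le> 1" using T[of t] t by simp
      finally show ?thesis using decay[OF t0 pX] invX[OF t0 pX] unfolding K_iff by simp
    qed
    then show ?thesis by (intro exI[of _ "max 0 T"]) auto
  qed
  have "compact K" unfolding K_def by (rule compact_fibre_cball)
  moreover have "K \<subseteq> X" unfolding K_def by blast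
  ultimately show "\<exists>A. compact_global_attractor S X A"
    using attractor_of_compact_absorbing_set[OF sfX _ _ K_ne K_inv absorb] by blast
qed

end

theorem theorem5:
  fixes K :: "('v, 'e, 'f) cell_complex"
    and val0 :: "'c0::real_inner \<Rightarrow> 'v \<Rightarrow> real"
    and val1 :: "'c1::real_inner \<Rightarrow> 'e \<Rightarrow> real"
    and val2 :: "'c2::real_inner \<Rightarrow> 'f \<Rightarrow> real"
    and d0 :: "'c0 \<Rightarrow> 'c1" and d1 :: "'c1 \<Rightarrow> 'c2"
    and B :: "'c1 \<Rightarrow> 'c1 \<Rightarrow> 'c1"
    and \<nu> \<eta> :: real
    and f g uH hH :: 'c1
    and S :: "real \<Rightarrow> 'c1 \<times> 'c1 \<Rightarrow> 'c1 \<times> 'c1"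
  assumes complex: "cochain_complex2 K val0 val1 val2 d0 d1"
    and bilin: "bilinear_on (divfree d0) B"
    and skew: "\<And>a b c. a \<in> divfree d0 \<Longrightarrow> b \<in> divfree d0 \<Longrightarrow> c \<in> divfree d0 \<Longrightarrow>
                 B a b \<bullet> c = - (B a c \<bullet> b)"
    and pos: "\<nu> > 0" "\<eta> > 0"
    and forcing: "projQ d0 d1 (projP d0 f) = 0" "projQ d0 d1 (projP d0 g) = 0"
    and semiflow: "generates_semiflow (divfree d0 \<times> divfree d0) (mhd_field d0 d1 B \<nu> \<eta> f g) S"
    and harm: "uH \<in> harmonic1 d0 d1" "hH \<in> harmonic1 d0 d1"
  shows
    "positively_invariant S (fibre d0 d1 uH hH)
     \<and>
     (projP0 d0 d1 (projP d0 f) = projP d0 f \<and> projP d0 f \<in> divfree_nonharm d0 d1 \<and>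
      projP0 d0 d1 (projP d0 g) = projP d0 g \<and> projP d0 g \<in> divfree_nonharm d0 d1 \<and>
      (\<forall>u h. solution_in (divfree d0 \<times> divfree d0) (mhd_field d0 d1 B \<nu> \<eta> f g) (\<lambda>t. (u t, h t)) \<and>
             (u 0, h 0) \<in> fibre d0 d1 uH hH \<longrightarrow>
         (let u0 = (\<lambda>t. projP0 d0 d1 (u t)); h0 = (\<lambda>t. projP0 d0 d1 (h t));
              R = op_sqrt (laplace1 d0 d1)
          in \<forall>t\<ge>0. \<exists>D.
               ((\<lambda>s. (norm (u0 s))\<^sup>2 + (norm (h0 s))\<^sup>2) has_real_derivative D) (at t within {0..}) \<and>
               1 / 2 * D + \<nu> * (norm (R (u0 t)))\<^sup>2 + \<eta> * (norm (R (h0 t)))\<^sup>2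
                 = projP0 d0 d1 (projP d0 f) \<bullet> u0 t + projP0 d0 d1 (projP d0 g) \<bullet> h0 t)))
     \<and>
     (\<exists>A. compact_global_attractor S (fibre d0 d1 uH hH) A)
     \<and>
     (f = 0 \<and> g = 0 \<longrightarrow>
      (\<forall>u h. solution_in (divfree d0 \<times> divfree d0) (mhd_field d0 d1 B \<nu> \<eta> f g) (\<lambda>t. (u t, h t)) \<and>
             (u 0, h 0) \<in> fibre d0 d1 uH hH \<longrightarrow>
         (divfree_nonharm d0 d1 \<noteq> {0} \<longrightarrow>
          (\<forall>t\<ge>0.
             (norm (projP0 d0 d1 (u t)))\<^sup>2 + (norm (projP0 d0 d1 (h t)))\<^sup>2
               \<le> ((norm (projP0 d0 d1 (u 0)))\<^sup>2 + (norm (projP0 d0 d1 (h 0)))\<^sup>2)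
                  * exp (- 2 * (min \<nu> \<eta> * lambda_plus d0 d1) * t))) \<and>
         ((\<lambda>t. (u t, h t)) \<longlongrightarrow> (uH, hH)) at_top))"
proof -
  have cc: "finite (verts K)" "finite (edges K)"
    "cochain_space (verts K) val0" "cochain_space (edges K) val1"
    using complex unfolding cochain_complex2_def finite_cell_complex2_def by auto
  interpret cochain_mhd d0 d1 B \<nu> \<eta> f g uH hH
  proof (intro cochain_mhd.intro hodge_complex.intro cochain_mhd_axioms.intro)
    show "linear d0" "linear d1" by (rule cochain_complex2_linear[OF complex])+
    show "d1 (d0 p) = 0" for p by (rule cochain_complex2_d1_d0[OF complex])
    show "finite_rank (UNIV :: 'c0 set)" "finite_rank (UNIV :: 'c1 set)"
      by (rule cochain_space_finite_rank[OF cc(3,1)], rule cochain_space_finite_rank[OF cc(4,2)])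
  qed (fact bilin skew pos forcing harm | rule skew; assumption)+
  have P0: "P0 (u t) = u t - uH" "P0 (h t) = h t - hH"
    if "solves u h" "(u 0, h 0) \<in> X" "t \<ge> 0" for u h t
    using fibre_P0[OF fibre_invariant[OF that]] by auto
  have balance: "\<forall>u h. solves u h \<and> (u 0, h 0) \<in> X \<longrightarrow>
      (\<forall>t\<ge>0. \<exists>D. ((\<lambda>s. (norm (P0 (u s)))\<^sup>2 + (norm (P0 (h s)))\<^sup>2) has_real_derivative D) (at t within {0..}) \<and>
        1 / 2 * D + \<nu> * (norm (op_sqrt Lap (P0 (u t))))\<^sup>2 + \<eta> * (norm (op_sqrt Lap (P0 (h t))))\<^sup>2
          = P0 (projP d0 f) \<bullet> P0 (u t) + P0 (projP d0 g) \<bullet> P0 (h t))"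
  proof (intro allI impI)
    fix u h and t :: real
    assume "solves u h \<and> (u 0, h 0) \<in> X" and t: "0 \<le> t"
    then have sol: "solves u h" "(u 0, h 0) \<in> X" by auto
    let ?D = "2 * (projP d0 f \<bullet> (u t - uH) + projP d0 g \<bullet> (h t - hH)
          - \<nu> * (Lap (u t - uH) \<bullet> (u t - uH)) - \<eta> * (Lap (h t - hH) \<bullet> (h t - hH)))"
    have "((\<lambda>s. (norm (P0 (u s)))\<^sup>2 + (norm (P0 (h s)))\<^sup>2) has_real_derivative ?D) (at t within {0..})"
      by (rule has_field_derivative_transform_within[OF energy_balance[OF sol t] zero_less_one])
         (use t P0[OF sol] in auto)
    moreover have "1 / 2 * ?D + \<nu> * (norm (op_sqrt Lap (P0 (u t))))\<^sup>2 + \<eta> * (norm (op_sqrt Lap (P0 (h t))))\<^sup>2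
          = P0 (projP d0 f) \<bullet> P0 (u t) + P0 (projP d0 g) \<bullet> P0 (h t)"
      by (simp add: norm_op_sqrt_Lap P0[OF sol t] forcing_P0 field_simps)
    ultimately show "\<exists>D. ((\<lambda>s. (norm (P0 (u s)))\<^sup>2 + (norm (P0 (h s)))\<^sup>2) has_real_derivative D) (at t within {0..}) \<and>
        1 / 2 * D + \<nu> * (norm (op_sqrt Lap (P0 (u t))))\<^sup>2 + \<eta> * (norm (op_sqrt Lap (P0 (h t))))\<^sup>2
          = P0 (projP d0 f) \<bullet> P0 (u t) + P0 (projP d0 g) \<bullet> P0 (h t)"
      by (intro exI[of _ ?D] conjI)
  qed
  have decay: "f = 0 \<and> g = 0 \<longrightarrow> (\<forall>u h. solves u h \<and> (u 0, h 0) \<in> X \<longrightarrow>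
      (V0 \<noteq> {0} \<longrightarrow> (\<forall>t\<ge>0. (norm (P0 (u t)))\<^sup>2 + (norm (P0 (h t)))\<^sup>2
        \<le> ((norm (P0 (u 0)))\<^sup>2 + (norm (P0 (h 0)))\<^sup>2) * exp (- 2 * (min \<nu> \<eta> * lambda_plus d0 d1) * t))) \<and>
      ((\<lambda>t. (u t, h t)) \<longlongrightarrow> (uH, hH)) at_top)"
  proof (intro allI impI conjI)
    fix u h
    assume "f = 0 \<and> g = 0" and "solves u h \<and> (u 0, h 0) \<in> X"
    then have zero: "f = 0" "g = 0" and sol: "solves u h" "(u 0, h 0) \<in> X" by auto
    show "((\<lambda>t. (u t, h t)) \<longlongrightarrow> (uH, hH)) at_top"
      by (rule unforced_convergence[OF sol zero])
    fix t :: real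
    assume ne: "V0 \<noteq> {0}" and t: "0 \<le> t"
    show "(norm (P0 (u t)))\<^sup>2 + (norm (P0 (h t)))\<^sup>2
        \<le> ((norm (P0 (u 0)))\<^sup>2 + (norm (P0 (h 0)))\<^sup>2) * exp (- 2 * (min \<nu> \<eta> * lambda_plus d0 d1) * t)"
      using unforced_energy_decay[OF lambda_plus_gap(2,1)[OF ne] sol t zero]
      unfolding P0[OF sol t] P0[OF sol order_refl] by simp
  qed
  show ?thesis
    unfolding Let_def
    using fibre_attractor[OF semiflow] forcing_P0 forcing_V0 balance decay
    by (intro conjI) assumption+
qed

end
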